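(* Let $M$ be a monoid with sofic group of units, all non-unit Schützenberger groups amenable, and finitely many $\mathcal{L}$-classes in each $\mathcal{D}$-class. Then $M$ is sofic.
   Context: Sofic monoids: Let $M$ be a monoid with identity $1$. For a finite subset $K \subseteq M$ and $\epsilon > 0$, a (left) $(K,\epsilon)$-action of $M$ on a non-empty finite set $X$ is a map $M \times X \to X$, $(m,x) \mapsto m \cdot x$ (not required to be an action) such that: (1) $1 \cdot x = x$ for all $x \in X$; (2) for all $g,h \in K$, the proportion of elements $x \in X$ with $g \cdot (h \cdot x) = (gh)\cdot x$ is at least $1-\epsilon$; (3) for all $g,h \in K$ with $g \neq h$, the proportion of elements $x \in X$ with $g \cdot x = h \cdot x$ is at most $\epsilon$. The monoid $M$ is (left) sofic, or simply sofic, if for every finite $K \subseteq M$ and every $\epsilon > 0$ there exist a non-empty finite set $X$ and a $(K,\epsilon)$-action of $M$ on $X$. A sofic group is a group that is sofic in the usual sense; this is known to be equivalent to being sofic as a monoid, i.e. to the condition that for every finite subset $K$ of the group and every $\epsilon > 0$ there exist a non-empty finite set $X$ and a $(K,\epsilon)$-action of the group on $X$. Green's relations on $M$ are the equivalence relations: $x \mathcal{L} y$ iff $Mx = My$; $x \mathcal{R} y$ iff $xM = yM$; $x \mathcal{H} y$ iff both $x \mathcal{L} y$ and $x \mathcal{R} y$; $x \mathcal{D} y$ iff there exists $z \in M$ with $x \mathcal{L} z$ and $z \mathcal{R} y$. Schützenberger groups: for an $\mathcal{H}$-class $H$ of $M$, let $\Sigma_H$ be the symmetric group on $H$, acting on $H$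 from the right with composition from left to right. The (right) Schützenberger group of $H$ is the subgroup $\{\sigma \in \Sigma_H \mid \text{there exists } m \in M \text{ with } h\sigma = hm \text{ for all } h \in H\}$ of $\Sigma_H$. The non-unit Schützenberger groups of $M$ are the Schützenberger groups of those $\mathcal{H}$-classes of $M$ that consist of non-units. Amenability is that of discrete groups. *)

theory Defs
  imports Complex_Main "HOL-Algebra.Bij" "HOL-Algebra.Coset"
begin

section \<open>Sofic monoids\<close>

text \<open>
  A \<open>(K,\<epsilon>)\<close>-action is only a map \<open>M \<times> X \<rightarrow> X\<close>; it need not be an action. The elements of
  \<open>K\<close> lie in the carrier; this is imposed in \<open>sofic_monoid\<close>.
\<close>

definition almost_action ::
    "('a, 'b) monoid_scheme \<Rightarrow> 'a set \<Rightarrow> real \<Rightarrow> 'x set \<Rightarrow> ('a \<Rightarrow> 'x \<Rightarrow> 'x) \<Rightarrow> bool" where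
  "almost_action M K \<epsilon> X act \<longleftrightarrow>
     act \<in> carrier M \<rightarrow> X \<rightarrow> X \<and>
     (\<forall>x\<in>X. act \<one>\<^bsub>M\<^esub> x = x) \<and>
     (\<forall>g\<in>K. \<forall>h\<in>K.
        real (card {x\<in>X. act g (act h x) = act (g \<otimes>\<^bsub>M\<^esub> h) x}) / real (card X) \<ge> 1 - \<epsilon>) \<and>
     (\<forall>g\<in>K. \<forall>h\<in>K. g \<noteq> h \<longrightarrow>
        real (card {x\<in>X. act g x = act h x}) / real (card X) \<le> \<epsilon>)"

text \<open>
  The finite sets \<open>X\<close> are taken to be sets of natural numbers; an arbitrary finite set can be
  replaced by such a set along a bijection, so there is no loss of generality.
\<close>

definition sofic_monoid :: "('a, 'b) monoid_scheme \<Rightarrow> bool" where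
  "sofic_monoid M \<longleftrightarrow> monoid M \<and>
     (\<forall>K \<epsilon>. finite K \<and> K \<subseteq> carrier M \<and> 0 < \<epsilon> \<longrightarrow>
        (\<exists>(X :: nat set) act. finite X \<and> X \<noteq> {} \<and> almost_action M K \<epsilon> X act))"


section \<open>Sofic groups\<close>

text \<open>
  Soficity of a group in the usual sense: approximate homomorphisms, with respect to the
  normalised Hamming distance, into finite symmetric groups \<^term>\<open>BijGroup X\<close>.
\<close>

definition hamming_dist :: "'x set \<Rightarrow> ('x \<Rightarrow> 'x) \<Rightarrow> ('x \<Rightarrow> 'x) \<Rightarrow> real" where
  "hamming_dist X \<sigma> \<tau> = real (card {x\<in>X. \<sigma> x \<noteq> \<tau> x}) / real (card X)"

definition almost_hom ::
    "('a, 'b) monoid_scheme \<Rightarrow> 'a set \<Rightarrow> real \<Rightarrow> 'x set \<Rightarrow> ('a \<Rightarrow> 'x \<Rightarrow> 'x) \<Rightarrow> bool" where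
  "almost_hom G K \<epsilon> X \<phi> \<longleftrightarrow>
     \<phi> \<in> carrier G \<rightarrow> carrier (BijGroup X) \<and>
     (\<forall>g\<in>K. \<forall>h\<in>K.
        hamming_dist X (\<phi> (g \<otimes>\<^bsub>G\<^esub> h)) (\<phi> g \<otimes>\<^bsub>BijGroup X\<^esub> \<phi> h) \<le> \<epsilon>) \<and>
     (\<forall>g\<in>K. \<forall>h\<in>K. g \<noteq> h \<longrightarrow> hamming_dist X (\<phi> g) (\<phi> h) \<ge> 1 - \<epsilon>)"

definition sofic_group :: "('a, 'b) monoid_scheme \<Rightarrow> bool" where
  "sofic_group G \<longleftrightarrow> group G \<and>
     (\<forall>K \<epsilon>. finite K \<and> K \<subseteq> carrier G \<and> 0 < \<epsilon> \<longrightarrow>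
        (\<exists>(X :: nat set) \<phi>. finite X \<and> X \<noteq> {} \<and> almost_hom G K \<epsilon> X \<phi>))"


section \<open>Amenable groups\<close>

text \<open>
  A discrete group is amenable if it carries a left-invariant, finitely additive probability
  measure defined on all of its subsets. The values of \<open>\<mu>\<close> on sets that are not contained in
  the carrier are irrelevant.
\<close>

definition amenable_group :: "('a, 'b) monoid_scheme \<Rightarrow> bool" where
  "amenable_group G \<longleftrightarrow> group G \<and>
     (\<exists>\<mu> :: 'a set \<Rightarrow> real.
        (\<forall>A. A \<subseteq> carrier G \<longrightarrow> 0 \<le> \<mu> A) \<and>
        \<mu> (carrier G) = 1 \<and>
        (\<forall>A B. A \<subseteq> carrier G \<and> B \<subseteq> carrier G \<and> A \<inter> B = {} \<longrightarrow> \<mu> (A \<union> B) = \<mu> A + \<mu> B) \<and>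
        (\<forall>g\<in>carrier G. \<forall>A. A \<subseteq> carrier G \<longrightarrow> \<mu> (g <#\<^bsub>G\<^esub> A) = \<mu> A))"


section \<open>Green's relations\<close>

text \<open>
  The principal left ideal \<open>Mx\<close> is \<^term>\<open>carrier M #>\<^bsub>M\<^esub> x\<close> and the principal right ideal
  \<open>xM\<close> is \<^term>\<open>x <#\<^bsub>M\<^esub> carrier M\<close>. The classes are the elements of the quotients
  \<open>carrier M // \<dots>\<close>.
\<close>

definition green_L :: "('a, 'b) monoid_scheme \<Rightarrow> ('a \<times> 'a) set" where
  "green_L M = {(x, y) \<in> carrier M \<times> carrier M. carrier M #>\<^bsub>M\<^esub> x = carrier M #>\<^bsub>M\<^esub> y}"

definition green_R :: "('a, 'b) monoid_scheme \<Rightarrow> ('a \<times> 'a) set" where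
  "green_R M = {(x, y) \<in> carrier M \<times> carrier M. x <#\<^bsub>M\<^esub> carrier M = y <#\<^bsub>M\<^esub> carrier M}"

definition green_H :: "('a, 'b) monoid_scheme \<Rightarrow> ('a \<times> 'a) set" where
  "green_H M = green_L M \<inter> green_R M"

definition green_D :: "('a, 'b) monoid_scheme \<Rightarrow> ('a \<times> 'a) set" where
  "green_D M = green_L M O green_R M"

lemma equiv_green_L: "equiv (carrier M) (green_L M)"
  by (rule equivI) (auto simp: green_L_def refl_on_def sym_def trans_def)

lemma equiv_green_R: "equiv (carrier M) (green_R M)"
  by (rule equivI) (auto simp: green_R_def refl_on_def sym_def trans_def)

lemma equiv_green_H: "equiv (carrier M) (green_H M)"
  by (rule equivI)
    (auto simp: green_H_def green_L_def green_R_def refl_on_def sym_def trans_def)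

lemma (in monoid) green_L_iff:
  "(x, y) \<in> green_L G \<longleftrightarrow> x \<in> carrier G \<and> y \<in> carrier G \<and>
     (\<exists>a\<in>carrier G. x = a \<otimes> y) \<and> (\<exists>b\<in>carrier G. y = b \<otimes> x)"
  (is "?l \<longleftrightarrow> ?r")
proof
  assume l: ?l
  then have c: "x \<in> carrier G" "y \<in> carrier G"
    and eq: "(\<Union>h\<in>carrier G. {h \<otimes> x}) = (\<Union>h\<in>carrier G. {h \<otimes> y})"
    by (auto simp: green_L_def r_coset_def)
  have "x \<in> (\<Union>h\<in>carrier G. {h \<otimes> x})" using c by (auto intro!: bexI[of _ \<one>])
  moreover have "y \<in> (\<Union>h\<in>carrier G. {h \<otimes> y})" using c by (auto intro!: bexI[of _ \<one>])
  ultimately show ?r using c eq by auto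
next
  assume r: ?r
  have sub: "carrier G #> u \<subseteq> carrier G #> v"
    if "v \<in> carrier G" "c \<in> carrier G" "u = c \<otimes> v" for u v c
  proof
    fix w assume "w \<in> carrier G #> u"
    then obtain h where h: "h \<in> carrier G" "w = h \<otimes> u" by (auto simp: r_coset_def)
    then have "w = (h \<otimes> c) \<otimes> v" using that by (simp add: m_assoc)
    moreover have "h \<otimes> c \<in> carrier G" using h that by simp
    ultimately show "w \<in> carrier G #> v" unfolding r_coset_def by blast
  qed
  from r obtain a b where "x \<in> carrier G" "y \<in> carrier G" "a \<in> carrier G" "b \<in> carrier G"
    "x = a \<otimes> y" "y = b \<otimes> x" by blast
  then have "carrier G #> x = carrier G #> y" using sub by (metis subset_antisym)
  with r show ?l unfolding green_L_def by blast
qed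

lemma (in monoid) green_R_iff:
  "(x, y) \<in> green_R G \<longleftrightarrow> x \<in> carrier G \<and> y \<in> carrier G \<and>
     (\<exists>a\<in>carrier G. x = y \<otimes> a) \<and> (\<exists>b\<in>carrier G. y = x \<otimes> b)"
  (is "?l \<longleftrightarrow> ?r")
proof
  assume l: ?l
  then have c: "x \<in> carrier G" "y \<in> carrier G"
    and eq: "(\<Union>h\<in>carrier G. {x \<otimes> h}) = (\<Union>h\<in>carrier G. {y \<otimes> h})"
    by (auto simp: green_R_def l_coset_def)
  have "x \<in> (\<Union>h\<in>carrier G. {x \<otimes> h})" using c by (auto intro!: bexI[of _ \<one>])
  moreover have "y \<in> (\<Union>h\<in>carrier G. {y \<otimes> h})" using c by (auto intro!: bexI[of _ \<one>])
  ultimately show ?r using c eq by auto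
next
  assume r: ?r
  have sub: "u <# carrier G \<subseteq> v <# carrier G"
    if "v \<in> carrier G" "c \<in> carrier G" "u = v \<otimes> c" for u v c
  proof
    fix w assume "w \<in> u <# carrier G"
    then obtain h where h: "h \<in> carrier G" "w = u \<otimes> h" by (auto simp: l_coset_def)
    then have "w = v \<otimes> (c \<otimes> h)" using that by (simp add: m_assoc)
    moreover have "c \<otimes> h \<in> carrier G" using h that by simp
    ultimately show "w \<in> v <# carrier G" unfolding l_coset_def by blast
  qed
  from r obtain a b where "x \<in> carrier G" "y \<in> carrier G" "a \<in> carrier G" "b \<in> carrier G"
    "x = y \<otimes> a" "y = x \<otimes> b" by blast
  then have "x <# carrier G = y <# carrier G" using sub by (metis subset_antisym)
  with r show ?l unfolding green_R_def by blast
qed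

lemma (in monoid) green_L_R_commute: "green_L G O green_R G = green_R G O green_L G"
proof -
  have "\<exists>w. (x, w) \<in> green_R G \<and> (w, y) \<in> green_L G"
    if "(x, z) \<in> green_L G" "(z, y) \<in> green_R G" for x y z
  proof -
    obtain a b where 1: "x \<in> carrier G" "z \<in> carrier G" "a \<in> carrier G" "b \<in> carrier G"
      "x = a \<otimes> z" "z = b \<otimes> x" using \<open>(x, z) \<in> green_L G\<close> unfolding green_L_iff by blast
    obtain c d where 2: "y \<in> carrier G" "c \<in> carrier G" "d \<in> carrier G"
      "z = y \<otimes> c" "y = z \<otimes> d" using \<open>(z, y) \<in> green_R G\<close> unfolding green_R_iff by blast
    have w: "a \<otimes> y = x \<otimes> d" using 1 2 by (metis m_assoc)
    have "x = (a \<otimes> y) \<otimes> c" using 1 2 by (metis m_assoc)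
    then have "(x, a \<otimes> y) \<in> green_R G" using 1 2 w unfolding green_R_iff by (metis m_closed)
    moreover have "y = b \<otimes> (a \<otimes> y)" using 1 2 w by (metis m_assoc)
    then have "(a \<otimes> y, y) \<in> green_L G" using 1 2 unfolding green_L_iff by (metis m_closed)
    ultimately show ?thesis by blast
  qed
  then have "green_L G O green_R G \<subseteq> green_R G O green_L G" by blast
  moreover have "green_R G O green_L G = (green_L G O green_R G)\<inverse>"
    using equiv_green_L[of G] equiv_green_R[of G]
    by (simp add: converse_relcomp equiv_def sym_conv_converse_eq)
  moreover have "(green_R G O green_L G)\<inverse> = green_L G O green_R G"
    using equiv_green_L[of G] equiv_green_R[of G]
    by (simp add: converse_relcomp equiv_def sym_conv_converse_eq)
  ultimately show ?thesis by blast
qed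

lemma (in monoid) equiv_green_D: "equiv (carrier G) (green_D G)"
proof (rule equivI)
  note L = equiv_green_L[of G] and R = equiv_green_R[of G]
  show "green_D G \<subseteq> carrier G \<times> carrier G"
    by (auto simp: green_D_def green_L_def green_R_def)
  show "refl_on (carrier G) (green_D G)"
    using L R unfolding green_D_def equiv_def refl_on_def by blast
  show "sym (green_D G)"
    unfolding green_D_def sym_conv_converse_eq converse_relcomp
    using L R green_L_R_commute by (simp add: equiv_def sym_conv_converse_eq)
  have "green_D G O green_D G = green_L G O (green_R G O green_L G) O green_R G"
    by (simp add: green_D_def O_assoc)
  also have "\<dots> = (green_L G O green_L G) O (green_R G O green_R G)"
    by (simp add: green_L_R_commute[symmetric] O_assoc)
  also have "\<dots> \<subseteq> green_D G"
    using L R unfolding green_D_def equiv_def trans_def by blast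
  finally show "trans (green_D G)" by (auto simp: trans_def)
qed


section \<open>Schuetzenberger groups\<close>

text \<open>
  The library's \<^term>\<open>BijGroup H\<close> composes from right to left. Permutations act from the right
  here, so the product \<open>\<sigma> \<tau>\<close> means first \<open>\<sigma>\<close>, then \<open>\<tau>\<close>.
\<close>

definition right_sym_group :: "'a set \<Rightarrow> ('a \<Rightarrow> 'a) monoid" where
  "right_sym_group H = (BijGroup H)\<lparr>mult := \<lambda>\<sigma> \<tau>. \<tau> \<otimes>\<^bsub>BijGroup H\<^esub> \<sigma>\<rparr>"

definition schutzenberger_group ::
    "('a, 'b) monoid_scheme \<Rightarrow> 'a set \<Rightarrow> ('a \<Rightarrow> 'a) monoid" where
  "schutzenberger_group M H = (right_sym_group H)\<lparr>carrier :=
     {\<sigma> \<in> carrier (right_sym_group H). \<exists>m\<in>carrier M. \<forall>h\<in>H. \<sigma> h = h \<otimes>\<^bsub>M\<^esub> m}\<rparr>"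

lemma right_sym_group_simps:
  "carrier (right_sym_group H) = Bij H"
  "\<one>\<^bsub>right_sym_group H\<^esub> = (\<lambda>x\<in>H. x)"
  "\<sigma> \<in> Bij H \<Longrightarrow> \<tau> \<in> Bij H \<Longrightarrow> \<sigma> \<otimes>\<^bsub>right_sym_group H\<^esub> \<tau> = compose H \<tau> \<sigma>"
  by (simp_all add: right_sym_group_def BijGroup_def)

lemma group_right_sym_group: "group (right_sym_group H)"
proof (rule groupI)
  interpret B: group "BijGroup H" by (rule group_BijGroup)
  show "\<exists>y\<in>carrier (right_sym_group H). y \<otimes>\<^bsub>right_sym_group H\<^esub> x = \<one>\<^bsub>right_sym_group H\<^esub>"
    if "x \<in> carrier (right_sym_group H)" for x
    using that by (auto simp: right_sym_group_def intro!: bexI[of _ "inv\<^bsub>BijGroup H\<^esub> x"])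
qed (use group.is_monoid[OF group_BijGroup[of H]] in
      \<open>auto simp: right_sym_group_def monoid.m_closed monoid.m_assoc monoid.r_one monoid.one_closed\<close>)

lemma (in monoid) subgroup_schutzenberger_group:
  assumes "H \<in> carrier G // green_H G"
  shows "subgroup (carrier (schutzenberger_group G H)) (right_sym_group H)"
proof -
  interpret S: group "right_sym_group H" by (rule group_right_sym_group)
  have Hc: "H \<subseteq> carrier G" using assms equiv_green_H[of G] by (metis Union_quotient Union_upper)
  have Hrel: "(x, y) \<in> green_H G" if "x \<in> H" "y \<in> H" for x y
    using assms that equiv_green_H[of G] by (metis quotient_eq_iff)
  have Hin: "y \<in> H" if "x \<in> H" "(x, y) \<in> green_H G" for x y
    using assms that equiv_green_H[of G] by (metis in_quotient_imp_closed)
  obtain h0 where h0: "h0 \<in> H"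
    using assms equiv_green_H[of G] by (metis in_quotient_imp_non_empty all_not_in_conv)
  define C where "C = {\<sigma> \<in> Bij H. \<exists>m\<in>carrier G. \<forall>h\<in>H. \<sigma> h = h \<otimes> m}"
  have C: "carrier (schutzenberger_group G H) = C"
    by (simp add: schutzenberger_group_def C_def right_sym_group_simps)
  have "subgroup C (right_sym_group H)"
  proof (rule S.subgroupI)
    show "C \<subseteq> carrier (right_sym_group H)" by (auto simp: C_def right_sym_group_simps)
    have "(\<lambda>x\<in>H. x) \<in> C" using Hc by (auto simp: C_def id_Bij intro!: bexI[of _ \<one>])
    then show "C \<noteq> {}" by blast
  next
    fix \<sigma> assume \<sigma>: "\<sigma> \<in> C"
    then have B: "\<sigma> \<in> Bij H" by (simp add: C_def)
    obtain m where m: "m \<in> carrier G" "\<And>h. h \<in> H \<Longrightarrow> \<sigma> h = h \<otimes> m" using \<sigma> by (auto simp: C_def)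
    define \<tau> where "\<tau> = inv\<^bsub>right_sym_group H\<^esub> \<sigma>"
    have \<tau>B: "\<tau> \<in> Bij H"
      using S.inv_closed[of \<sigma>] B by (simp add: \<tau>_def right_sym_group_simps)
    have "\<sigma> \<otimes>\<^bsub>right_sym_group H\<^esub> \<tau> = \<one>\<^bsub>right_sym_group H\<^esub>"
      "\<tau> \<otimes>\<^bsub>right_sym_group H\<^esub> \<sigma> = \<one>\<^bsub>right_sym_group H\<^esub>"
      using S.r_inv[of \<sigma>] S.l_inv[of \<sigma>] B by (simp_all add: \<tau>_def right_sym_group_simps)
    then have "compose H \<tau> \<sigma> = (\<lambda>x\<in>H. x)" "compose H \<sigma> \<tau> = (\<lambda>x\<in>H. x)"
      using B \<tau>B by (simp_all add: right_sym_group_simps)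
    then have inv1: "\<tau> (\<sigma> h) = h" and inv2: "\<sigma> (\<tau> h) = h" if "h \<in> H" for h
      using that by (metis compose_eq restrict_apply')+
    have \<tau>H: "\<tau> h \<in> H" if "h \<in> H" for h using \<tau>B that Bij_imp_funcset by blast
    have "(\<tau> h0, h0) \<in> green_R G" using Hrel[OF \<tau>H[OF h0] h0] by (simp add: green_H_def)
    then obtain n where n: "n \<in> carrier G" "\<tau> h0 = h0 \<otimes> n" unfolding green_R_iff by blast
    have "\<tau> h = h \<otimes> n" if h: "h \<in> H" for h
    proof -
      have hc: "h \<in> carrier G" "h0 \<in> carrier G" using h h0 Hc by auto
      have "(h, h0) \<in> green_L G" using Hrel[OF h h0] by (simp add: green_H_def)
      then obtain a c where a: "a \<in> carrier G" "h = a \<otimes> h0" and c: "c \<in> carrier G" "h0 = c \<otimes> h"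
        unfolding green_L_iff by blast
      have h0nm: "h0 \<otimes> n \<otimes> m = h0" using inv2[OF h0] m(2)[OF \<tau>H[OF h0]] n(2) by simp
      have hnm: "h \<otimes> n \<otimes> m = h" using h0nm a n m hc by (metis m_assoc m_closed)
      have "(h, h \<otimes> n) \<in> green_R G"
        unfolding green_R_iff using hc n m hnm by (metis m_closed)
      moreover have "(h \<otimes> n, \<tau> h0) \<in> green_L G"
        unfolding green_L_iff n(2) using hc n a c by (metis m_assoc m_closed)
      moreover have "(\<tau> h0, h) \<in> green_L G" using Hrel[OF \<tau>H[OF h0] h] by (simp add: green_H_def)
      ultimately have "(h, h \<otimes> n) \<in> green_H G"
        using equiv_green_L[of G] unfolding green_H_def equiv_def sym_def trans_def by blast
      then have "h \<otimes> n \<in> H" using Hin h by blast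
      then have "\<tau> (h \<otimes> n \<otimes> m) = h \<otimes> n" using inv1 m(2) by metis
      then show ?thesis using hnm by simp
    qed
    then show "inv\<^bsub>right_sym_group H\<^esub> \<sigma> \<in> C"
      using \<tau>B n(1) unfolding C_def \<tau>_def by blast
  next
    fix \<sigma> \<tau> assume st: "\<sigma> \<in> C" "\<tau> \<in> C"
    then have B: "\<sigma> \<in> Bij H" "\<tau> \<in> Bij H" by (simp_all add: C_def)
    obtain m n where m: "m \<in> carrier G" "\<And>h. h \<in> H \<Longrightarrow> \<sigma> h = h \<otimes> m"
      and n: "n \<in> carrier G" "\<And>h. h \<in> H \<Longrightarrow> \<tau> h = h \<otimes> n" using st by (auto simp: C_def)
    have sH: "\<sigma> h \<in> H" if "h \<in> H" for h using B(1) that Bij_imp_funcset by blast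
    have "compose H \<tau> \<sigma> h = h \<otimes> (m \<otimes> n)" if "h \<in> H" for h
    proof -
      have "compose H \<tau> \<sigma> h = \<tau> (\<sigma> h)" using that by (simp add: compose_eq)
      also have "\<dots> = h \<otimes> m \<otimes> n" using n(2)[OF sH[OF that]] m(2)[OF that] by simp
      finally show ?thesis using that Hc m n by (metis m_assoc subsetD)
    qed
    then have "compose H \<tau> \<sigma> \<in> C"
      using m n B compose_Bij[of \<tau> H \<sigma>] by (auto simp: C_def intro!: bexI[of _ "m \<otimes> n"])
    then show "\<sigma> \<otimes>\<^bsub>right_sym_group H\<^esub> \<tau> \<in> C" using B by (simp add: right_sym_group_simps)
  qed
  then show ?thesis by (simp add: C)
qed

lemma (in monoid) group_schutzenberger_group:
  assumes "H \<in> carrier G // green_H G"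
  shows "group (schutzenberger_group G H)"
proof -
  interpret S: group "right_sym_group H" by (rule group_right_sym_group)
  have "schutzenberger_group G H =
      (right_sym_group H)\<lparr>carrier := carrier (schutzenberger_group G H)\<rparr>"
    by (simp add: schutzenberger_group_def)
  then show ?thesis
    using S.subgroup_imp_group[OF subgroup_schutzenberger_group[OF assms]] by simp
qed

end

theory Submission
  imports Defs "HOL-Algebra.Product_Groups"
begin

text \<open>
  The non-units of \<open>M\<close> form an ideal: if \<open>a b = 1\<close> and \<open>a\<close> is not a unit, then the powers of \<open>a\<close>
  lie in infinitely many \<open>\<L>\<close>-classes of the \<open>\<D>\<close>-class of \<open>1\<close>, but there are only finitely many
  (\<open>directly_finite_if_finite_L_classes\<close>).

  The conditions on products and on separation in an almost action speak only of most points, so a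
  non-unit may send almost every point into a negligible set, in which hardly anything has to be
  checked. Let \<open>N\<close> be
  the finite set of non-units among the elements of \<open>K\<close> and their products, let \<open>\<Omega>\<close> be the union of
  the \<open>\<D>\<close>-classes that meet \<open>N\<close>, and let \<open>Q\<close> be the group of right translations \<open>\<rho> u\<close> of \<open>\<Omega>\<close> by
  units \<open>u\<close>. Given a sofic approximation \<open>\<phi>\<close> of the group of units on a finite set \<open>X\<close> and a Foelner
  set \<open>F\<close> of \<open>Q\<close>, let a unit \<open>u\<close> send \<open>(x, q) \<in> X \<times> F\<close> to \<open>(\<phi> u x, \<rho> u q)\<close>, and let \<open>n \<in> N\<close> send
  \<open>(x, q)\<close> to the element \<open>q n\<close> of \<open>M\<close>; on the finite set \<open>Y\<close> of these elements \<open>M\<close> acts by left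
  multiplication, as long as this does not lead out of \<open>Y\<close>. Products in \<open>Q\<close> are composed from left
  to right, so \<open>n (u (x, q)) = (\<rho> u q) n = q (n u) = (n u) (x, q)\<close>; right translations commute with
  left multiplications, so \<open>m (n (x, q)) = m (q n) = q (m n) = (m n) (x, q)\<close>. Two units are separated
  by \<open>X\<close>, and two elements of \<open>N\<close> because \<open>q\<close> is injective. Taking many copies of \<open>X \<times> F\<close> makes \<open>Y\<close>
  negligible. This is \<open>sofic_if_folner_unit_translations\<close>.

  It remains to see that \<open>Q\<close> has Foelner sets (\<open>folner_group_unit_translations\<close>). As \<open>\<Omega>\<close> contains
  only finitely many \<open>\<L>\<close>-classes, the elements of \<open>Q\<close> that fix each of them form a subgroup of finite
  index. On an \<open>\<L>\<close>-class \<open>L\<close> such an element is determined by its value at one point \<open>b\<close>, since it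
  commutes with left multiplications, and on the \<open>\<H>\<close>-class of \<open>b\<close> it is a member of the
  Schuetzenberger group. So the subgroup embeds in a finite product of amenable groups.

  Amenability is given by a finitely additive measure, so Foelner's theorem is proved as well
  (\<open>folner_group_if_amenable\<close>): in a group without Foelner sets, Hall's theorem yields a paradoxical
  decomposition. Products, subgroups and extensions of finite index are then dealt with by means
  of Foelner sets.
\<close>

section \<open>Hall's marriage theorem for infinite families of finite sets\<close>

text \<open>
  Rado's proof. Call a family that satisfies Hall's condition tight if no element can be removed from
  one of its members. If a member of a tight family had two elements, then removing either of them
  would break the condition at some finite sets \<open>J\<close> and \<open>K\<close> of indices, and submodularity of the
  cardinality contradicts the condition at \<open>J \<union> K\<close>, with the index of that member added, and at
  \<open>J \<inter> K\<close>. So the members of a tight family are singletons. As the condition concerns finitely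
  many members at a time, and these are finite, Zorn's lemma provides a tight subfamily.
\<close>
lemma hall_marriage:
  fixes N :: "'i \<Rightarrow> 'c set"
  assumes fin: "\<And>i. i \<in> I \<Longrightarrow> finite (N i)"
    and hall: "\<And>J. finite J \<Longrightarrow> J \<subseteq> I \<Longrightarrow> card J \<le> card (\<Union>(N ` J))"
  shows "\<exists>f. inj_on f I \<and> (\<forall>i\<in>I. f i \<in> N i)"
proof -
  \<comment> \<open>Recording the removed pairs, not the remaining family, turns lower bounds of chains into unions.\<close>
  define P where "P R i = {x \<in> N i. (i, x) \<notin> R}" for R i
  define A where "A = {R. R \<subseteq> Sigma I N \<and>
    (\<forall>J. finite J \<longrightarrow> J \<subseteq> I \<longrightarrow> card J \<le> card (\<Union>(P R ` J)))}"
  have chain: "\<Union>C \<in> A" if C: "subset.chain A C" for C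
  proof (cases "C = {}")
    case True
    then show ?thesis using hall by (simp add: A_def P_def)
  next
    case False
    have CA: "C \<subseteq> A" using C by (simp add: subset.chain_def)
    have "card J \<le> card (\<Union>(P (\<Union>C) ` J))" if J: "finite J" "J \<subseteq> I" for J
    proof -
      have "finite (Sigma J N \<inter> \<Union>C)" using J fin by (intro finite_Int disjI1 finite_SigmaI) auto
      then obtain R where R: "R \<in> C" "Sigma J N \<inter> \<Union>C \<subseteq> R"
        using finite_subset_Union_chain[OF _ _ False C] by (metis Int_lower2)
      have "P (\<Union>C) j = P R j" if "j \<in> J" for j using R that by (auto simp: P_def)
      then have "(\<Union>(P (\<Union>C) ` J)) = (\<Union>(P R ` J))" by simp
      moreover have "card J \<le> card (\<Union>(P R ` J))" using R(1) CA J by (auto simp: A_def)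
      ultimately show ?thesis by simp
    qed
    then show ?thesis using CA by (auto simp: A_def)
  qed
  obtain R where R: "R \<in> A" and max: "\<And>X. X \<in> A \<Longrightarrow> R \<subseteq> X \<Longrightarrow> X = R"
    using subset_Zorn'[of A] chain by metis
  have finP: "finite (P R i)" if "i \<in> I" for i using fin[OF that] by (simp add: P_def)
  have hallP: "card J \<le> card (\<Union>(P R ` J))" if "finite J" "J \<subseteq> I" for J
    using R that by (simp add: A_def)
  have critical: "\<exists>J. finite J \<and> J \<subseteq> I \<and> i \<notin> J \<and> card (\<Union>(P R ` J) \<union> (P R i - {x})) \<le> card J"
    if i: "i \<in> I" and x: "x \<in> P R i" for i x
  proof -
    have "(i, x) \<notin> R" using x by (simp add: P_def)
    then have "insert (i, x) R \<notin> A" using max[of "insert (i, x) R"] by blast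
    moreover have "insert (i, x) R \<subseteq> Sigma I N" using R i x by (auto simp: A_def P_def)
    ultimately obtain J where J: "finite J" "J \<subseteq> I" "card (\<Union>(P (insert (i, x) R) ` J)) < card J"
      by (auto simp: A_def not_le)
    have eq: "P (insert (i, x) R) j = (if j = i then P R i - {x} else P R j)" for j
      by (auto simp: P_def)
    have "i \<in> J"
    proof (rule ccontr)
      assume "i \<notin> J"
      then have "\<Union>(P (insert (i, x) R) ` J) = \<Union>(P R ` J)" by (auto simp: eq)
      then show False using J hallP[of J] by simp
    qed
    moreover have "\<Union>(P (insert (i, x) R) ` J) = \<Union>(P R ` (J - {i})) \<union> (P R i - {x})"
      using \<open>i \<in> J\<close> by (auto simp: eq)
    ultimately have "card (\<Union>(P R ` (J - {i})) \<union> (P R i - {x})) \<le> card (J - {i})"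
      using J by simp
    then show ?thesis using J by (intro exI[of _ "J - {i}"]) auto
  qed
  \<comment> \<open>Submodularity: the two critical sets of indices are incompatible.\<close>
  have single: "x = y" if i: "i \<in> I" and xy: "x \<in> P R i" "y \<in> P R i" for i x y
  proof (rule ccontr)
    assume ne: "x \<noteq> y"
    obtain J where J: "finite J" "J \<subseteq> I" "i \<notin> J" "card (\<Union>(P R ` J) \<union> (P R i - {x})) \<le> card J"
      using critical[OF i xy(1)] by blast
    obtain K where K: "finite K" "K \<subseteq> I" "i \<notin> K" "card (\<Union>(P R ` K) \<union> (P R i - {y})) \<le> card K"
      using critical[OF i xy(2)] by blast
    let ?U = "\<Union>(P R ` J) \<union> (P R i - {x})" and ?V = "\<Union>(P R ` K) \<union> (P R i - {y})"
    have finUV: "finite ?U" "finite ?V" using J K finP i by (auto intro!: finite_UN_I)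
    have "card (insert i (J \<union> K)) \<le> card (\<Union>(P R ` insert i (J \<union> K)))"
      using J K i by (intro hallP) auto
    also have "\<Union>(P R ` insert i (J \<union> K)) = ?U \<union> ?V" using ne by auto
    finally have 1: "card (J \<union> K) + 1 \<le> card (?U \<union> ?V)" using J K by simp
    have "card (J \<inter> K) \<le> card (\<Union>(P R ` (J \<inter> K)))" using J by (intro hallP) auto
    also have "\<dots> \<le> card (?U \<inter> ?V)" using finUV by (intro card_mono) auto
    finally have 2: "card (J \<inter> K) \<le> card (?U \<inter> ?V)" .
    have "card ?U + card ?V = card (?U \<union> ?V) + card (?U \<inter> ?V)"
      using card_Un_Int[OF finUV] .
    moreover have "card J + card K = card (J \<union> K) + card (J \<inter> K)"
      using J K card_Un_Int by blast
    ultimately show False using 1 2 J(4) K(4) by linarith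
  qed
  have "\<exists>x. x \<in> P R i" if "i \<in> I" for i
    using hallP[of "{i}"] that by (cases "P R i = {}") auto
  then obtain f where f: "\<And>i. i \<in> I \<Longrightarrow> f i \<in> P R i" by metis
  have "f i \<noteq> f j" if "i \<in> I" "j \<in> I" "i \<noteq> j" for i j
  proof
    assume eq: "f i = f j"
    have "\<Union>(P R ` {i, j}) \<subseteq> {f i}" using single f that eq by auto
    then have "card (\<Union>(P R ` {i, j})) \<le> 1" using card_mono[of "{f i}"] by fastforce
    then show False using hallP[of "{i, j}"] that by simp
  qed
  then show ?thesis using f by (intro exI[of _ f]) (auto simp: inj_on_def P_def)
qed


section \<open>Foelner sets in groups\<close>

text \<open>
  Foelner's condition. Requiring one bound for all of \<open>T\<close> at once, rather than a bound for each
  element of \<open>T\<close>, is equivalent and makes the closure properties simpler.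
\<close>
definition folner_group :: "('a, 'b) monoid_scheme \<Rightarrow> bool" where
  "folner_group G \<longleftrightarrow>
     (\<forall>T \<epsilon>. finite T \<and> T \<subseteq> carrier G \<and> 0 < \<epsilon> \<longrightarrow>
        (\<exists>F. finite F \<and> F \<noteq> {} \<and> F \<subseteq> carrier G \<and>
           real (card {f \<in> F. \<exists>t\<in>T. t \<otimes>\<^bsub>G\<^esub> f \<notin> F}) \<le> \<epsilon> * real (card F)))"

lemma folner_groupE:
  assumes "folner_group G" "finite T" "T \<subseteq> carrier G" "0 < \<epsilon>"
  obtains F where "finite F" "F \<noteq> {}" "F \<subseteq> carrier G"
    "real (card {f \<in> F. \<exists>t\<in>T. t \<otimes>\<^bsub>G\<^esub> f \<notin> F}) \<le> \<epsilon> * real (card F)"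
proof -
  have "\<exists>F. finite F \<and> F \<noteq> {} \<and> F \<subseteq> carrier G \<and>
           real (card {f \<in> F. \<exists>t\<in>T. t \<otimes>\<^bsub>G\<^esub> f \<notin> F}) \<le> \<epsilon> * real (card F)"
    using assms by (simp add: folner_group_def)
  then show ?thesis using that by (elim exE conjE)
qed

lemma finitely_additive_sum:
  fixes \<mu> :: "'a set \<Rightarrow> real"
  assumes add: "\<And>A B. A \<subseteq> C \<Longrightarrow> B \<subseteq> C \<Longrightarrow> A \<inter> B = {} \<Longrightarrow> \<mu> (A \<union> B) = \<mu> A + \<mu> B"
    and "finite I" "\<And>i. i \<in> I \<Longrightarrow> B i \<subseteq> C"
    and "\<And>i j. i \<in> I \<Longrightarrow> j \<in> I \<Longrightarrow> i \<noteq> j \<Longrightarrow> B i \<inter> B j = {}"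
  shows "\<mu> (\<Union>(B ` I)) = (\<Sum>i\<in>I. \<mu> (B i))"
  using assms(2-)
proof (induction I)
  case empty
  then show ?case using add[of "{}" "{}"] by simp
next
  case (insert i I)
  have "\<mu> (\<Union>(B ` insert i I)) = \<mu> (B i) + \<mu> (\<Union>(B ` I))"
  proof -
    have "B i \<inter> B j = {}" if "j \<in> I" for j using insert.prems(2)[of i j] insert.hyps that by auto
    then have "B i \<inter> \<Union>(B ` I) = {}" by blast
    moreover have "B i \<subseteq> C" "\<Union>(B ` I) \<subseteq> C" using insert.prems(1) by auto
    ultimately show ?thesis using add[of "B i" "\<Union>(B ` I)"] by simp
  qed
  then show ?case using insert by simp
qed

text \<open>
  Without Foelner sets, some finite set \<open>S\<close> expands every finite set by a factor \<open>1 + \<delta>\<close>; a power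
  of \<open>S\<close> then expands by a factor of two.
\<close>
lemma (in group) expansion_of_not_folner:
  assumes "\<not> folner_group G"
  obtains S where "finite S" "S \<subseteq> carrier G"
    "\<And>F. finite F \<Longrightarrow> F \<subseteq> carrier G \<Longrightarrow> 2 * card F \<le> card (S <#> F)"
proof -
  obtain T \<epsilon> where T: "finite T" "T \<subseteq> carrier G" "0 < \<epsilon>"
    and no: "\<not> (\<exists>F. finite F \<and> F \<noteq> {} \<and> F \<subseteq> carrier G \<and>
      real (card {f \<in> F. \<exists>t\<in>T. t \<otimes> f \<notin> F}) \<le> \<epsilon> * real (card F))"
    using assms unfolding folner_group_def by blast
  have big: "real (card {f \<in> F. \<exists>t\<in>T. t \<otimes> f \<notin> F}) > \<epsilon> * real (card F)"
    if "finite F" "F \<noteq> {}" "F \<subseteq> carrier G" for F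
  proof (rule ccontr)
    assume "\<not> ?thesis"
    with that have "finite F \<and> F \<noteq> {} \<and> F \<subseteq> carrier G \<and>
      real (card {f \<in> F. \<exists>t\<in>T. t \<otimes> f \<notin> F}) \<le> \<epsilon> * real (card F)" by simp
    with no show False by (rule_tac notE) (assumption, rule exI)
  qed
  define \<delta> where "\<delta> = \<epsilon> / (real (card T) + 1)"
  have \<delta>: "0 < \<delta>" using T by (simp add: \<delta>_def)
  \<comment> \<open>With \<open>\<one>\<close> in \<open>S\<close>, the product \<open>S F\<close> contains both \<open>F\<close> and what \<open>T\<close> moves out of \<open>F\<close>.\<close>
  define S where "S = insert \<one> T"
  have S: "finite S" "S \<subseteq> carrier G" using T by (auto simp: S_def)
  have finmult: "finite (A <#> B)" if "finite A" "finite B" for A B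
    using that by (auto simp: set_mult_def)
  have step: "(1 + \<delta>) * real (card F) \<le> real (card (S <#> F))"
    if F: "finite F" "F \<subseteq> carrier G" for F
  proof (cases "F = {}")
    case False
    let ?bad = "\<lambda>t. {f \<in> F. t \<otimes> f \<notin> F}"
    have FS: "F \<subseteq> S <#> F" using F by (auto simp: S_def set_mult_def subset_iff)
    have bad: "card (?bad t) \<le> card ((S <#> F) - F)" if "t \<in> T" for t
    proof (rule card_inj_on_le)
      show "inj_on (\<lambda>f. t \<otimes> f) (?bad t)" 
        using F T that by (intro inj_onI) (auto simp: subset_iff)
      show "(\<lambda>f. t \<otimes> f) ` ?bad t \<subseteq> (S <#> F) - F" using that by (auto simp: S_def set_mult_def)
      show "finite ((S <#> F) - F)" using S F finmult by simp
    qed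
    have "{f \<in> F. \<exists>t\<in>T. t \<otimes> f \<notin> F} = (\<Union>t\<in>T. ?bad t)" by auto
    then have "card {f \<in> F. \<exists>t\<in>T. t \<otimes> f \<notin> F} \<le> (\<Sum>t\<in>T. card (?bad t))"
      using card_UN_le[OF T(1), of ?bad] by simp
    also have "\<dots> \<le> card T * card ((S <#> F) - F)" using sum_bounded_above[OF bad] by simp
    finally have "real (card {f \<in> F. \<exists>t\<in>T. t \<otimes> f \<notin> F}) \<le> real (card T * card ((S <#> F) - F))"
      by (rule of_nat_mono)
    with big[OF F(1) False F(2)]
    have "\<epsilon> * real (card F) \<le> real (card T) * real (card ((S <#> F) - F))" by simp
    also have "\<dots> \<le> (real (card T) + 1) * real (card ((S <#> F) - F))" by (simp add: algebra_simps)
    finally have "\<delta> * real (card F) \<le> real (card ((S <#> F) - F))"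
      by (simp add: \<delta>_def field_simps)
    moreover have "card (S <#> F) = card F + card ((S <#> F) - F)"
      using card_Un_disjoint[of F "(S <#> F) - F"] FS F S finmult by (simp add: Un_absorb1)
    ultimately show ?thesis by (simp add: algebra_simps)
  qed simp
  have iter: "\<exists>S. finite S \<and> S \<subseteq> carrier G \<and>
      (\<forall>F. finite F \<longrightarrow> F \<subseteq> carrier G \<longrightarrow> (1 + \<delta>) ^ n * real (card F) \<le> real (card (S <#> F)))" for n
  proof (induction n)
    case 0
    have "{\<one>} <#> F = F" if "F \<subseteq> carrier G" for F using that by (force simp: set_mult_def)
    then show ?case by (intro exI[of _ "{\<one>}"]) auto
  next
    case (Suc n)
    then obtain S' where S': "finite S'" "S' \<subseteq> carrier G"
      "\<And>F. finite F \<Longrightarrow> F \<subseteq> carrier G \<Longrightarrow> (1 + \<delta>) ^ n * real (card F) \<le> real (card (S' <#> F))"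
      by blast
    have "(1 + \<delta>) ^ Suc n * real (card F) \<le> real (card ((S <#> S') <#> F))"
      if F: "finite F" "F \<subseteq> carrier G" for F
    proof -
      have "(1 + \<delta>) ^ Suc n * real (card F) \<le> (1 + \<delta>) * real (card (S' <#> F))"
        using S'(3)[OF F] \<delta> by (simp add: mult.assoc)
      also have "\<dots> \<le> real (card (S <#> (S' <#> F)))"
        using F S' by (intro step finmult set_mult_closed)
      also have "S <#> (S' <#> F) = (S <#> S') <#> F"
        using F S S' by (simp add: set_mult_assoc)
      finally show ?thesis .
    qed
    then show ?case using S S' finmult set_mult_closed by (intro exI[of _ "S <#> S'"]) auto
  qed
  obtain n where n: "2 < (1 + \<delta>) ^ n" using real_arch_pow[of "1 + \<delta>" 2] \<delta> by auto
  obtain S' where S': "finite S'" "S' \<subseteq> carrier G"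
    and grow: "\<And>F. finite F \<Longrightarrow> F \<subseteq> carrier G \<Longrightarrow> (1 + \<delta>) ^ n * real (card F) \<le> real (card (S' <#> F))"
    using iter[of n] by blast
  have "2 * card F \<le> card (S' <#> F)" if F: "finite F" "F \<subseteq> carrier G" for F
  proof -
    have "2 * real (card F) \<le> (1 + \<delta>) ^ n * real (card F)"
      using n by (intro mult_right_mono) auto
    also have "\<dots> \<le> real (card (S' <#> F))" using grow[OF F] .
    finally show ?thesis by linarith
  qed
  then show ?thesis using that S' by blast
qed

text \<open>
  If \<open>G\<close> has no Foelner sets, Hall's theorem applies to \<open>(x, b) \<mapsto> S x\<close>, where \<open>b\<close> is a Boolean: it
  yields two injections of \<open>G\<close> into itself with disjoint images, each moving every \<open>x\<close> to some
  \<open>s x\<close> with \<open>s \<in> S\<close>. Cutting \<open>G\<close> according to \<open>s\<close> gives finitely many pieces of total measure \<open>2\<close>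
  with pairwise disjoint translates, which an invariant probability measure does not allow.
\<close>
theorem folner_group_if_amenable:
  fixes G (structure)
  assumes "amenable_group G"
  shows "folner_group G"
proof (rule ccontr)
  assume nf: "\<not> folner_group G"
  interpret group G using assms by (simp add: amenable_group_def)
  from assms obtain \<mu> :: "'a set \<Rightarrow> real" where \<mu>:
    "(\<forall>A. A \<subseteq> carrier G \<longrightarrow> 0 \<le> \<mu> A) \<and> \<mu> (carrier G) = 1 \<and>
     (\<forall>A B. A \<subseteq> carrier G \<and> B \<subseteq> carrier G \<and> A \<inter> B = {} \<longrightarrow> \<mu> (A \<union> B) = \<mu> A + \<mu> B) \<and>
     (\<forall>g\<in>carrier G. \<forall>A. A \<subseteq> carrier G \<longrightarrow> \<mu> (g <# A) = \<mu> A)"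
    unfolding amenable_group_def by (elim conjE exE) (rule that, intro conjI)
  then have nonneg: "\<And>A. A \<subseteq> carrier G \<Longrightarrow> 0 \<le> \<mu> A"
    and total: "\<mu> (carrier G) = 1"
    and add: "\<And>A B. A \<subseteq> carrier G \<Longrightarrow> B \<subseteq> carrier G \<Longrightarrow> A \<inter> B = {} \<Longrightarrow> \<mu> (A \<union> B) = \<mu> A + \<mu> B"
    and inv: "\<And>g A. g \<in> carrier G \<Longrightarrow> A \<subseteq> carrier G \<Longrightarrow> \<mu> (g <# A) = \<mu> A"
    by simp_all
  obtain S where S: "finite S" "S \<subseteq> carrier G"
    and exp: "\<And>F. finite F \<Longrightarrow> F \<subseteq> carrier G \<Longrightarrow> 2 * card F \<le> card (S <#> F)"
    using expansion_of_not_folner[OF nf] by blast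
  define I where "I = carrier G \<times> (UNIV :: bool set)"
  define N where "N p = (\<lambda>s. s \<otimes> fst p) ` S" for p :: "'a \<times> bool"
  have "\<exists>f. inj_on f I \<and> (\<forall>p\<in>I. f p \<in> N p)"
  proof (rule hall_marriage)
    fix J assume J: "finite J" "J \<subseteq> I"
    have "card J \<le> card (fst ` J \<times> (UNIV :: bool set))"
      using J by (intro card_mono) (auto intro: rev_image_eqI)
    also have "\<dots> = 2 * card (fst ` J)" by (simp add: card_cartesian_product)
    also have "\<dots> \<le> card (S <#> fst ` J)" using J by (intro exp) (auto simp: I_def)
    also have "S <#> fst ` J = \<Union>(N ` J)" by (auto simp: set_mult_def N_def)
    finally show "card J \<le> card (\<Union>(N ` J))" .
  qed (simp add: N_def S)
  then obtain f where f: "inj_on f I" "\<And>p. p \<in> I \<Longrightarrow> \<exists>s\<in>S. f p = s \<otimes> fst p"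
    by (auto simp: N_def image_iff)
  then obtain s where s: "\<And>p. p \<in> I \<Longrightarrow> s p \<in> S" "\<And>p. p \<in> I \<Longrightarrow> f p = s p \<otimes> fst p" by metis
  define A where "A b t = {x \<in> carrier G. s (x, b) = t}" for b t
  have A: "A b t \<subseteq> carrier G" for b t by (auto simp: A_def)
  have one: "(\<Sum>t\<in>S. \<mu> (A b t)) = 1" for b
  proof -
    have "\<mu> (\<Union>(A b ` S)) = (\<Sum>t\<in>S. \<mu> (A b t))"
      using S A by (intro finitely_additive_sum[where C = "carrier G"] add) (auto simp: A_def)
    moreover have "\<Union>(A b ` S) = carrier G" using s(1) by (auto simp: A_def I_def)
    ultimately show ?thesis using total by simp
  qed
  define B where "B p = snd p <# A (fst p) (snd p)" for p
  have B: "B p \<subseteq> carrier G" if "p \<in> UNIV \<times> S" for p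
    using that S A l_coset_subset_G unfolding B_def by (metis mem_Times_iff subsetD)
  have disj: "B p \<inter> B q = {}" if "p \<noteq> q" for p q
  proof -
    have memB: "\<exists>x \<in> carrier G. s (x, fst r) = snd r \<and> z = f (x, fst r)" if z: "z \<in> B r" for r z
    proof -
      obtain x where "x \<in> A (fst r) (snd r)" "z = snd r \<otimes> x"
        using z by (auto simp: B_def l_coset_def)
      then show ?thesis using s(2)[of "(x, fst r)"] by (auto simp: A_def I_def)
    qed
    have "z \<notin> B q" if z: "z \<in> B p" for z
    proof
      assume "z \<in> B q"
      then obtain y where y: "y \<in> carrier G" "s (y, fst q) = snd q" "z = f (y, fst q)" using memB by blast
      obtain x where x: "x \<in> carrier G" "s (x, fst p) = snd p" "z = f (x, fst p)" using memB z by blast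
      have "(x, fst p) = (y, fst q)"
        using f(1) x y by (auto simp: I_def inj_on_def)
      then show False using x y that \<open>p \<noteq> q\<close> by (metis prod.inject prod_eq_iff)
    qed
    then show ?thesis by blast
  qed
  have "\<mu> (\<Union>(B ` (UNIV \<times> S))) = (\<Sum>p\<in>UNIV \<times> S. \<mu> (B p))"
    using S B disj by (intro finitely_additive_sum[where C = "carrier G"] add) auto
  also have "\<dots> = (\<Sum>p\<in>UNIV \<times> S. \<mu> (A (fst p) (snd p)))"
    using S A by (intro sum.cong) (auto simp: B_def inv subset_iff)
  also have "\<dots> = (\<Sum>b\<in>UNIV. \<Sum>t\<in>S. \<mu> (A b t))"
    by (simp add: sum.cartesian_product case_prod_beta)
  also have "\<dots> = 2" by (simp add: one)
  finally have two: "\<mu> (\<Union>(B ` (UNIV \<times> S))) = 2" .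
  have U: "\<Union>(B ` (UNIV \<times> S)) \<subseteq> carrier G" using B by blast
  then have "1 = \<mu> (\<Union>(B ` (UNIV \<times> S))) + \<mu> (carrier G - \<Union>(B ` (UNIV \<times> S)))"
    using add[OF U, of "carrier G - \<Union>(B ` (UNIV \<times> S))"] total by (simp add: Un_absorb1)
  then show False using two nonneg[of "carrier G - \<Union>(B ` (UNIV \<times> S))"] by simp
qed


text \<open>
  A product of Foelner sets is a Foelner set: a point of it is bad only if one of its coordinates is.
\<close>
theorem folner_group_product:
  assumes I: "finite I" and folner: "\<And>i. i \<in> I \<Longrightarrow> folner_group (G i)"
  shows "folner_group (product_group I G)"
  unfolding folner_group_def
proof (intro allI impI, elim conjE)
  fix T and \<epsilon> :: real
  assume T: "finite T" "T \<subseteq> carrier (product_group I G)" and \<epsilon>: "0 < \<epsilon>"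
  \<comment> \<open>The summand \<open>1\<close> keeps the quotient meaningful for empty \<open>I\<close>.\<close>
  define \<delta> where "\<delta> = \<epsilon> / (real (card I) + 1)"
  have \<delta>: "0 < \<delta>" using \<epsilon> by (simp add: \<delta>_def)
  define bad where "bad i F = {f \<in> F. \<exists>t\<in>T. t i \<otimes>\<^bsub>G i\<^esub> f \<notin> F}" for i F
  have "\<exists>F. finite F \<and> F \<noteq> {} \<and> F \<subseteq> carrier (G i) \<and>
      real (card (bad i F)) \<le> \<delta> * real (card F)" if i: "i \<in> I" for i
  proof -
    have fin: "finite ((\<lambda>t. t i) ` T)" and sub: "(\<lambda>t. t i) ` T \<subseteq> carrier (G i)" using T i by auto
    obtain F where F: "finite F" "F \<noteq> {}" "F \<subseteq> carrier (G i)"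
      "real (card {f \<in> F. \<exists>t\<in>(\<lambda>t. t i) ` T. t \<otimes>\<^bsub>G i\<^esub> f \<notin> F}) \<le> \<delta> * real (card F)"
      by (rule folner_groupE[OF folner[OF i] fin sub \<delta>])
    have "{f \<in> F. \<exists>t\<in>(\<lambda>t. t i) ` T. t \<otimes>\<^bsub>G i\<^esub> f \<notin> F} = bad i F" by (auto simp: bad_def)
    then show ?thesis using F by (intro exI[of _ F]) simp
  qed
  then obtain F where F: "\<And>i. i \<in> I \<Longrightarrow> finite (F i)" "\<And>i. i \<in> I \<Longrightarrow> F i \<noteq> {}"
      "\<And>i. i \<in> I \<Longrightarrow> F i \<subseteq> carrier (G i)"
      "\<And>i. i \<in> I \<Longrightarrow> real (card (bad i (F i))) \<le> \<delta> * real (card (F i))"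
    by metis
  define A where "A = PiE I F"
  have "finite A" "A \<noteq> {}" using I F by (auto simp: A_def PiE_eq_empty_iff intro!: finite_PiE)
  moreover have "A \<subseteq> carrier (product_group I G)"
    unfolding A_def carrier_product_group by (intro PiE_mono F)
  ultimately have A: "finite A" "A \<noteq> {}" "A \<subseteq> carrier (product_group I G)" .
  define B where "B i = {p \<in> A. p i \<in> bad i (F i)}" for i
  have cardB: "real (card (B i)) \<le> \<delta> * real (card A)" if i: "i \<in> I" for i
  proof -
    have sub: "bad i (F i) \<subseteq> F i" by (auto simp: bad_def)
    have "B i = PiE I (F(i := bad i (F i)))"
    proof (rule subset_antisym; rule subsetI)
      fix p assume "p \<in> B i"
      then show "p \<in> PiE I (F(i := bad i (F i)))" by (simp add: B_def A_def PiE_iff)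
    next
      fix p assume p: "p \<in> PiE I (F(i := bad i (F i)))"
      have "p j \<in> F j" if "j \<in> I" for j
        using PiE_mem[OF p that] sub by (cases "j = i") auto
      moreover have "p i \<in> bad i (F i)" using PiE_mem[OF p i] by simp
      ultimately show "p \<in> B i" using p by (simp add: B_def A_def PiE_iff)
    qed
    then have "card (B i) = card (bad i (F i)) * (\<Prod>j\<in>I - {i}. card (F j))"
      using I i by (simp add: card_PiE prod.remove)
    also have "real \<dots> = real (card (bad i (F i))) * (\<Prod>j\<in>I - {i}. real (card (F j)))" by simp
    also have "\<dots> \<le> (\<delta> * real (card (F i))) * (\<Prod>j\<in>I - {i}. real (card (F j)))"
      by (intro mult_right_mono F i prod_nonneg) auto
    also have "\<dots> = \<delta> * real (card A)"
      using I i by (simp add: A_def card_PiE prod.remove)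
    finally show ?thesis .
  qed
  have "{p \<in> A. \<exists>t\<in>T. t \<otimes>\<^bsub>product_group I G\<^esub> p \<notin> A} \<subseteq> (\<Union>i\<in>I. B i)"
    by (auto simp: A_def B_def bad_def PiE_iff)
  then have "card {p \<in> A. \<exists>t\<in>T. t \<otimes>\<^bsub>product_group I G\<^esub> p \<notin> A} \<le> card (\<Union>i\<in>I. B i)"
    using I A by (intro card_mono) (auto simp: B_def)
  also have "\<dots> \<le> (\<Sum>i\<in>I. card (B i))" using I by (rule card_UN_le)
  finally have "real (card {p \<in> A. \<exists>t\<in>T. t \<otimes>\<^bsub>product_group I G\<^esub> p \<notin> A}) \<le> (\<Sum>i\<in>I. real (card (B i)))"
    using of_nat_mono by fastforce
  also have "\<dots> \<le> real (card I) * (\<delta> * real (card A))"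
    by (intro sum_bounded_above cardB)
  also have "\<dots> \<le> \<epsilon> * real (card A)"
  proof -
    have "real (card I) * \<delta> \<le> \<epsilon>" using \<epsilon> by (simp add: \<delta>_def field_simps)
    then show ?thesis by (metis mult.assoc mult_right_mono of_nat_0_le_iff)
  qed
  finally show "\<exists>F. finite F \<and> F \<noteq> {} \<and> F \<subseteq> carrier (product_group I G) \<and>
      real (card {f \<in> F. \<exists>t\<in>T. t \<otimes>\<^bsub>product_group I G\<^esub> f \<notin> F}) \<le> \<epsilon> * real (card F)"
    using A by blast
qed

text \<open>
  The cosets \<open>h(G) p\<close> partition a Foelner set of \<open>P\<close>. By averaging, the proportion of bad points in
  one of the parts is not above that in the whole set, and this part is a copy of a subset of \<open>G\<close>.
\<close>
theorem folner_group_if_inj_hom: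
  assumes "group G" "group P" and h: "h \<in> hom G P" "inj_on h (carrier G)" and "folner_group P"
  shows "folner_group G"
  unfolding folner_group_def
proof (intro allI impI, elim conjE)
  fix T and \<epsilon> :: real
  assume T: "finite T" "T \<subseteq> carrier G" and \<epsilon>: "0 < \<epsilon>"
  interpret G: group G by fact
  interpret P: group P by fact
  interpret h: group_hom G P h using h(1) by unfold_locales
  have fin: "finite (h ` T)" and sub: "h ` T \<subseteq> carrier P" using T by auto
  obtain F where F: "finite F" "F \<noteq> {}" "F \<subseteq> carrier P"
    and small: "real (card {f \<in> F. \<exists>t\<in>h ` T. t \<otimes>\<^bsub>P\<^esub> f \<notin> F}) \<le> \<epsilon> * real (card F)"
    by (rule folner_groupE[OF \<open>folner_group P\<close> fin sub \<epsilon>])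
  define bad where "bad = {f \<in> F. \<exists>t\<in>h ` T. t \<otimes>\<^bsub>P\<^esub> f \<notin> F}"
  have finbad: "finite bad" using F by (simp add: bad_def)
  define c where "c p = (\<lambda>g. h g \<otimes>\<^bsub>P\<^esub> p) ` carrier G" for p
  have "\<exists>y\<in>c ` F. real (card {x \<in> bad. c x = y}) \<le> \<epsilon> * real (card {x \<in> F. c x = y})"
  proof (rule ccontr)
    assume "\<not> ?thesis"
    then have "(\<Sum>y\<in>c ` F. \<epsilon> * real (card {x \<in> F. c x = y})) < (\<Sum>y\<in>c ` F. real (card {x \<in> bad. c x = y}))"
      using F by (intro sum_strict_mono) (auto simp: not_le)
    moreover have "(\<Sum>y\<in>c ` F. \<Sum>x | x \<in> F \<and> c x = y. (1::nat)) = (\<Sum>x\<in>F. 1)"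
      using F by (intro sum.group) auto
    moreover have "(\<Sum>y\<in>c ` F. \<Sum>x | x \<in> bad \<and> c x = y. (1::nat)) = (\<Sum>x\<in>bad. 1)"
      using F finbad by (intro sum.group) (auto simp: bad_def)
    ultimately have "\<epsilon> * real (card F) < real (card bad)"
      by (simp flip: sum_distrib_left of_nat_sum)
    then show False using small by (simp add: bad_def)
  qed
  then obtain p where p: "p \<in> F"
    and le: "real (card {x \<in> bad. c x = c p}) \<le> \<epsilon> * real (card {x \<in> F. c x = c p})" by blast
  have pP: "p \<in> carrier P" using p F by blast
  define \<theta> where "\<theta> g = h g \<otimes>\<^bsub>P\<^esub> p" for g
  have cI: "c (\<theta> g) = c p" if g: "g \<in> carrier G" for g
  proof -
    have 1: "h k \<otimes>\<^bsub>P\<^esub> \<theta> g = \<theta> (k \<otimes>\<^bsub>G\<^esub> g)" if "k \<in> carrier G" for k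
      using that g pP by (simp add: \<theta>_def P.m_assoc)
    have "c (\<theta> g) = \<theta> ` (\<lambda>k. k \<otimes>\<^bsub>G\<^esub> g) ` carrier G"
      unfolding c_def image_image by (intro image_cong refl 1)
    also have "(\<lambda>k. k \<otimes>\<^bsub>G\<^esub> g) ` carrier G = carrier G"
    proof
      show "carrier G \<subseteq> (\<lambda>k. k \<otimes>\<^bsub>G\<^esub> g) ` carrier G"
      proof
        fix x assume "x \<in> carrier G"
        then show "x \<in> (\<lambda>k. k \<otimes>\<^bsub>G\<^esub> g) ` carrier G"
          using g by (intro image_eqI[where x = "x \<otimes>\<^bsub>G\<^esub> inv\<^bsub>G\<^esub> g"]) (simp_all add: G.m_assoc)
      qed
    qed (use g in auto)
    finally show ?thesis by (simp add: c_def \<theta>_def)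
  qed
  have cD: "\<exists>g\<in>carrier G. x = \<theta> g" if "x \<in> carrier P" "c x = c p" for x
  proof -
    have "x = h \<one>\<^bsub>G\<^esub> \<otimes>\<^bsub>P\<^esub> x" using that(1) by simp
    then have "x \<in> c x" unfolding c_def by (rule image_eqI) simp
    then have "x \<in> c p" using that(2) by simp
    then show ?thesis by (auto simp: c_def \<theta>_def)
  qed
  have inj: "inj_on \<theta> A" if "A \<subseteq> carrier G" for A
    using h(2) that pP by (auto simp: \<theta>_def inj_on_def subset_iff)
  define E where "E = {g \<in> carrier G. \<theta> g \<in> F}"
  have E: "\<theta> ` E = {x \<in> F. c x = c p}"
  proof (rule subset_antisym; rule subsetI)
    fix x assume "x \<in> {x \<in> F. c x = c p}"
    then show "x \<in> \<theta> ` E" using cD[of x] F by (auto simp: E_def)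
  qed (use cI in \<open>auto simp: E_def\<close>)
  have "E \<subseteq> carrier G" by (auto simp: E_def)
  have "finite (\<theta> ` E)" using E F by simp
  then have "finite E" using inj[OF \<open>E \<subseteq> carrier G\<close>] by (rule finite_imageD)
  moreover have "\<one>\<^bsub>G\<^esub> \<in> E" using p pP by (simp add: E_def \<theta>_def)
  moreover have "real (card {g \<in> E. \<exists>t\<in>T. t \<otimes>\<^bsub>G\<^esub> g \<notin> E}) \<le> \<epsilon> * real (card E)"
  proof -
    have "\<theta> ` {g \<in> E. \<exists>t\<in>T. t \<otimes>\<^bsub>G\<^esub> g \<notin> E} \<subseteq> {x \<in> bad. c x = c p}"
    proof
      fix x assume "x \<in> \<theta> ` {g \<in> E. \<exists>t\<in>T. t \<otimes>\<^bsub>G\<^esub> g \<notin> E}"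
      then obtain g t where gt: "g \<in> E" "t \<in> T" "t \<otimes>\<^bsub>G\<^esub> g \<notin> E" "x = \<theta> g" by blast
      then have gc: "g \<in> carrier G" "t \<in> carrier G" using T by (auto simp: E_def)
      have "h t \<otimes>\<^bsub>P\<^esub> \<theta> g = \<theta> (t \<otimes>\<^bsub>G\<^esub> g)" using gc pP by (simp add: \<theta>_def P.m_assoc)
      then have "h t \<otimes>\<^bsub>P\<^esub> x \<notin> F" using gt gc by (simp add: E_def)
      then show "x \<in> {x \<in> bad. c x = c p}" using gt gc cI by (auto simp: bad_def E_def)
    qed
    then have "card (\<theta> ` {g \<in> E. \<exists>t\<in>T. t \<otimes>\<^bsub>G\<^esub> g \<notin> E}) \<le> card {x \<in> bad. c x = c p}"
      using finbad by (intro card_mono) auto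
    then have "card {g \<in> E. \<exists>t\<in>T. t \<otimes>\<^bsub>G\<^esub> g \<notin> E} \<le> card {x \<in> bad. c x = c p}"
      by (subst (asm) card_image) (auto intro!: inj simp: E_def)
    moreover have "card E = card {x \<in> F. c x = c p}"
      unfolding E[symmetric] by (intro card_image[symmetric] inj) (auto simp: E_def)
    ultimately show ?thesis using le by simp
  qed
  ultimately show "\<exists>F. finite F \<and> F \<noteq> {} \<and> F \<subseteq> carrier G \<and>
      real (card {f \<in> F. \<exists>t\<in>T. t \<otimes>\<^bsub>G\<^esub> f \<notin> F}) \<le> \<epsilon> * real (card F)"
    by (intro exI[of _ E]) (auto simp: E_def)
qed

text \<open>
  If \<open>R\<close> represents the left cosets of \<open>S\<close>, then \<open>t r = r' s\<close> with \<open>r' \<in> R\<close> and \<open>s \<in> S\<close> for all \<open>t\<close>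
  and \<open>r \<in> R\<close>. So \<open>t r F = r' s F\<close> is nearly contained in \<open>R F\<close> if \<open>F\<close> is a Foelner set of \<open>S\<close> for
  the finitely many \<open>s\<close> that occur.
\<close>
theorem (in group) folner_group_if_finite_index:
  assumes S: "subgroup S G" and folner: "folner_group (G\<lparr>carrier := S\<rparr>)"
    and index: "finite ((\<lambda>x. x <# S) ` carrier G)"
  shows "folner_group G"
  unfolding folner_group_def
proof (intro allI impI, elim conjE)
  fix T and \<epsilon> :: real
  assume T: "finite T" "T \<subseteq> carrier G" and \<epsilon>: "0 < \<epsilon>"
  interpret S: subgroup S G by fact
  define c where "c C = (SOME y. y \<in> carrier G \<and> y <# S = C)" for C
  have c: "c (x <# S) \<in> carrier G" "c (x <# S) <# S = x <# S" if "x \<in> carrier G" for x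
    using someI[of "\<lambda>y. y \<in> carrier G \<and> y <# S = x <# S" x] that by (auto simp: c_def)
  define R where "R = c ` (\<lambda>x. x <# S) ` carrier G"
  have R: "finite R" "R \<subseteq> carrier G" "R \<noteq> {}" using index c by (auto simp: R_def)
  define s where "s t r = inv (c ((t \<otimes> r) <# S)) \<otimes> (t \<otimes> r)" for t r
  have s: "s t r \<in> S" "t \<otimes> r = c ((t \<otimes> r) <# S) \<otimes> s t r" if "t \<in> T" "r \<in> R" for t r
  proof -
    have tr: "t \<otimes> r \<in> carrier G" using that T R by auto
    have "t \<otimes> r \<in> c ((t \<otimes> r) <# S) <# S"
      unfolding c(2)[OF tr] using tr S.one_closed by (force simp: l_coset_def)
    then obtain x where x: "x \<in> S" "t \<otimes> r = c ((t \<otimes> r) <# S) \<otimes> x"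
      by (auto simp: l_coset_def)
    have "s t r = inv (c ((t \<otimes> r) <# S)) \<otimes> (c ((t \<otimes> r) <# S) \<otimes> x)"
      unfolding s_def using x(2) by (rule arg_cong)
    also have "\<dots> = x" using c(1)[OF tr] S.mem_carrier[OF x(1)] by (simp flip: m_assoc)
    finally show "s t r \<in> S" using x(1) by simp
    show "t \<otimes> r = c ((t \<otimes> r) <# S) \<otimes> s t r" using c(1)[OF tr] tr by (simp add: s_def flip: m_assoc)
  qed
  have fin: "finite ((\<lambda>(t, r). s t r) ` (T \<times> R))"
    and sub: "(\<lambda>(t, r). s t r) ` (T \<times> R) \<subseteq> carrier (G\<lparr>carrier := S\<rparr>)"
    using T R s by auto
  obtain F where "finite F" "F \<noteq> {}" "F \<subseteq> carrier (G\<lparr>carrier := S\<rparr>)"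
    "real (card {f \<in> F. \<exists>t\<in>(\<lambda>(t, r). s t r) ` (T \<times> R). t \<otimes>\<^bsub>G\<lparr>carrier := S\<rparr>\<^esub> f \<notin> F}) \<le> \<epsilon> * real (card F)"
    by (rule folner_groupE[OF folner fin sub \<epsilon>])
  then have F: "finite F" "F \<noteq> {}" "F \<subseteq> S"
    and small: "real (card {f \<in> F. \<exists>t\<in>(\<lambda>(t, r). s t r) ` (T \<times> R). t \<otimes> f \<notin> F}) \<le> \<epsilon> * real (card F)"
    by simp_all
  define bad where "bad = {f \<in> F. \<exists>t\<in>(\<lambda>(t, r). s t r) ` (T \<times> R). t \<otimes> f \<notin> F}"
  define m where "m = (\<lambda>(r, f). r \<otimes> f)"
  have cR: "c (r <# S) = r" if "r \<in> R" for r
    using that c(2) unfolding R_def by (elim imageE) simp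
  have coset: "(r \<otimes> f) <# S = r <# S" if "r \<in> R" "f \<in> F" for r f
    using that R F S by (intro l_repr_independence[symmetric]) (auto simp: l_coset_def)
  have inj: "inj_on m (R \<times> F)"
  proof -
    have "r = r' \<and> f = f'" if rf: "r \<in> R" "r' \<in> R" "f \<in> F" "f' \<in> F" and eq: "r \<otimes> f = r' \<otimes> f'" for r r' f f'
    proof -
      have "r = r'"
        using cR[OF rf(1)] cR[OF rf(2)] coset[OF rf(1,3)] coset[OF rf(2,4)] eq by simp
      moreover have "r \<in> carrier G" "f \<in> carrier G" "f' \<in> carrier G"
        using rf R F S.subset by auto
      ultimately show ?thesis using eq by simp
    qed
    then show ?thesis unfolding m_def inj_on_def by auto
  qed
  define E where "E = m ` (R \<times> F)"
  have E: "finite E" "E \<noteq> {}" "E \<subseteq> carrier G" "card E = card R * card F"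
    using R F S.subset inj by (auto simp: E_def m_def card_image card_cartesian_product subset_iff)
  have "{x \<in> E. \<exists>t\<in>T. t \<otimes> x \<notin> E} \<subseteq> m ` (R \<times> bad)"
  proof
    fix x assume "x \<in> {x \<in> E. \<exists>t\<in>T. t \<otimes> x \<notin> E}"
    then obtain r f t where rft: "r \<in> R" "f \<in> F" "t \<in> T" "t \<otimes> (r \<otimes> f) \<notin> E" "x = r \<otimes> f"
      by (auto simp: E_def m_def)
    have rc: "r \<in> carrier G" "t \<in> carrier G" "f \<in> carrier G" "s t r \<in> carrier G"
      using rft R T F S.subset s(1) by auto
    have c': "c ((t \<otimes> r) <# S) \<in> R" "c ((t \<otimes> r) <# S) \<in> carrier G" using rc c by (auto simp: R_def)
    have "t \<otimes> (r \<otimes> f) = (t \<otimes> r) \<otimes> f" using rc by (simp add: m_assoc)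
    also have "\<dots> = c ((t \<otimes> r) <# S) \<otimes> (s t r \<otimes> f)"
      using s(2)[OF rft(3,1)] rc c' by (metis m_assoc)
    finally have "s t r \<otimes> f \<notin> F" using rft c' by (auto simp: E_def m_def)
    then have "f \<in> bad" using rft by (auto simp: bad_def)
    then show "x \<in> m ` (R \<times> bad)" using rft by (auto simp: m_def)
  qed
  then have "card {x \<in> E. \<exists>t\<in>T. t \<otimes> x \<notin> E} \<le> card (R \<times> bad)"
    using R F by (intro surj_card_le[where f = m]) (auto simp: bad_def)
  then have "real (card {x \<in> E. \<exists>t\<in>T. t \<otimes> x \<notin> E}) \<le> real (card R) * real (card bad)"
    by (simp add: card_cartesian_product flip: of_nat_mult)
  also have "\<dots> \<le> real (card R) * (\<epsilon> * real (card F))"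
    using small by (intro mult_left_mono) (auto simp: bad_def)
  also have "\<dots> = \<epsilon> * real (card E)" by (simp add: E)
  finally show "\<exists>F. finite F \<and> F \<noteq> {} \<and> F \<subseteq> carrier G \<and>
      real (card {f \<in> F. \<exists>t\<in>T. t \<otimes> f \<notin> F}) \<le> \<epsilon> * real (card F)"
    using E by blast
qed


section \<open>Green's relations and units\<close>

lemma (in monoid) green_L_mult_right:
  assumes "(x, y) \<in> green_L G" "g \<in> carrier G"
  shows "(x \<otimes> g, y \<otimes> g) \<in> green_L G"
  using assms unfolding green_L_iff by (metis m_assoc m_closed)

lemma (in monoid) green_R_mult_unit:
  assumes "x \<in> carrier G" "g \<in> Units G"
  shows "(x, x \<otimes> g) \<in> green_R G"
proof -
  have "x = x \<otimes> g \<otimes> inv g" using assms by (simp add: m_assoc Units_closed)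
  then show ?thesis using assms unfolding green_R_iff by (metis Units_closed Units_inv_closed m_closed)
qed

lemma (in monoid) green_L_subset_green_D: "green_L G \<subseteq> green_D G"
  using equiv_green_R[of G] by (auto simp: green_D_def green_L_def equiv_def refl_on_def)

lemma (in monoid) green_R_subset_green_D: "green_R G \<subseteq> green_D G"
  using equiv_green_L[of G] by (auto simp: green_D_def green_R_def equiv_def refl_on_def)

text \<open>
  Equivalently, one-sided inverses are two-sided, or the non-units form an ideal.
\<close>
locale directly_finite_monoid = monoid +
  assumes unit_if_right_invertible:
    "\<lbrakk>a \<in> carrier G; b \<in> carrier G; a \<otimes> b = \<one>\<rbrakk> \<Longrightarrow> a \<in> Units G"
begin

lemma mult_in_Units_iff:
  assumes "x \<in> carrier G" "y \<in> carrier G"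
  shows "x \<otimes> y \<in> Units G \<longleftrightarrow> x \<in> Units G \<and> y \<in> Units G"
proof
  assume u: "x \<otimes> y \<in> Units G"
  have "x \<otimes> (y \<otimes> inv (x \<otimes> y)) = \<one>" using u assms by (simp flip: m_assoc)
  then have x: "x \<in> Units G" using unit_if_right_invertible assms u by (metis Units_inv_closed m_closed)
  have "inv x \<otimes> (x \<otimes> y) = y" using x assms by (simp flip: m_assoc)
  then have "y \<in> Units G" using x u by (metis Units_inv_Units Units_m_closed)
  with x show "x \<in> Units G \<and> y \<in> Units G" ..
qed auto

lemma green_D_Units:
  assumes "(x, y) \<in> green_D G"
  shows "x \<in> Units G \<longleftrightarrow> y \<in> Units G"
proof -
  obtain z where "(x, z) \<in> green_L G" "(z, y) \<in> green_R G" using assms by (auto simp: green_D_def)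
  then show ?thesis unfolding green_L_iff green_R_iff by (metis mult_in_Units_iff)
qed

end

text \<open>
  If \<open>a b = 1\<close>, then every power of \<open>a\<close> is \<open>\<R>\<close>-related to \<open>1\<close>, so two powers \<open>a^i\<close> and \<open>a^j\<close> with
  \<open>i < j\<close> are \<open>\<L>\<close>-related. Multiplying \<open>a^i = c a^j\<close> by \<open>b^i\<close> on the right gives a left inverse
  of \<open>a\<close>.
\<close>
lemma (in monoid) directly_finite_if_finite_L_classes:
  assumes fin: "finite {L \<in> carrier G // green_L G. L \<subseteq> green_D G `` {\<one>}}"
  shows "directly_finite_monoid G"
proof
  fix a b assume a: "a \<in> carrier G" and b: "b \<in> carrier G" and ab: "a \<otimes> b = \<one>"
  have pow: "a [^] n \<otimes> b [^] n = \<one>" for n :: nat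
  proof (induction n)
    case (Suc n)
    have "a [^] Suc n \<otimes> b [^] Suc n = a [^] n \<otimes> (a \<otimes> b) \<otimes> b [^] n"
      using a b nat_pow_Suc2[OF b, of n] by (simp add: m_assoc)
    then show ?case using Suc a b ab by simp
  qed simp
  define L where "L n = green_L G `` {a [^] n}" for n :: nat
  have "L n \<in> {L \<in> carrier G // green_L G. L \<subseteq> green_D G `` {\<one>}}" for n
  proof -
    have "(a [^] n, \<one>) \<in> green_R G"
      using a b pow[of n] unfolding green_R_iff by (metis l_one nat_pow_closed one_closed)
    then have "L n \<subseteq> green_D G `` {\<one>}"
      using equiv_green_D equiv_green_L[of G]
      unfolding L_def green_D_def equiv_def sym_def by blast
    then show ?thesis using a by (simp add: L_def quotientI)
  qed
  then have "finite (range L)" using fin by (meson finite_subset image_subsetI)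
  then have "\<not> inj L" using finite_imageD infinite_UNIV_nat by blast
  then obtain i j where ij: "i < j" "L i = L j" by (metis injI linorder_neqE_nat)
  have "(a [^] i, a [^] j) \<in> green_L G"
    using ij(2) a equiv_green_L[of G] unfolding L_def by (metis eq_equiv_class nat_pow_closed)
  then obtain c where c: "c \<in> carrier G" "a [^] i = c \<otimes> a [^] j" unfolding green_L_iff by blast
  obtain k where k: "j = Suc k + i" using ij(1) by (metis add.commute add_Suc less_natE)
  have "a [^] j = a [^] Suc k \<otimes> a [^] i" unfolding k by (rule nat_pow_mult[OF a, symmetric])
  then have ai: "a [^] i = c \<otimes> (a [^] Suc k \<otimes> a [^] i)" using c(2) by (rule subst)
  have "\<one> = a [^] i \<otimes> b [^] i" by (simp only: pow)
  also have "\<dots> = c \<otimes> (a [^] Suc k \<otimes> a [^] i) \<otimes> b [^] i"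
    by (rule arg_cong[OF ai])
  also have "\<dots> = c \<otimes> a [^] Suc k \<otimes> (a [^] i \<otimes> b [^] i)"
    using a b c(1) by (simp add: m_assoc del: nat_pow_Suc)
  also have "\<dots> = (c \<otimes> a [^] k) \<otimes> a" using a c(1) by (simp add: pow m_assoc)
  finally have "(c \<otimes> a [^] k) \<otimes> a = \<one>" ..
  moreover have "c \<otimes> a [^] k \<in> carrier G" using a c by simp
  ultimately show "a \<in> Units G"
    using a b ab inv_unique[of "c \<otimes> a [^] k" a b] unfolding Units_def by auto
qed


section \<open>Right translations by units\<close>

definition right_translation :: "('a, 'b) monoid_scheme \<Rightarrow> 'a set \<Rightarrow> 'a \<Rightarrow> 'a \<Rightarrow> 'a" where
  "right_translation M \<Omega> g = (\<lambda>x\<in>\<Omega>. x \<otimes>\<^bsub>M\<^esub> g)"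

text \<open>
  The product is that of \<^const>\<open>right_sym_group\<close>, first the left factor and then the right one, so
  that \<open>g \<mapsto> right_translation M \<Omega> g\<close> is a homomorphism on the units.
\<close>
definition unit_translations :: "('a, 'b) monoid_scheme \<Rightarrow> 'a set \<Rightarrow> ('a \<Rightarrow> 'a) monoid" where
  "unit_translations M \<Omega> = (right_sym_group \<Omega>)\<lparr>carrier := right_translation M \<Omega> ` Units M\<rparr>"

locale translated_set = monoid +
  fixes \<Omega>
  assumes \<Omega>_carrier: "\<Omega> \<subseteq> carrier G"
    and mult_unit_closed: "\<lbrakk>x \<in> \<Omega>; g \<in> Units G\<rbrakk> \<Longrightarrow> x \<otimes> g \<in> \<Omega>"
begin

abbreviation "\<rho> \<equiv> right_translation G \<Omega>"
abbreviation "Q \<equiv> unit_translations G \<Omega>"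

lemma translation_Bij:
  assumes g: "g \<in> Units G"
  shows "\<rho> g \<in> Bij \<Omega>"
proof -
  have inverse: "x \<otimes> g \<otimes> inv g = x" "x \<otimes> inv g \<otimes> g = x" if "x \<in> \<Omega>" for x
    using that g \<Omega>_carrier by (auto simp: m_assoc Units_closed subset_iff)
  have "bij_betw (\<lambda>x. x \<otimes> g) \<Omega> \<Omega>"
    by (rule bij_betw_byWitness[where f' = "\<lambda>x. x \<otimes> inv g"])
      (use g inverse mult_unit_closed in auto)
  then show ?thesis by (simp add: Bij_def right_translation_def cong: bij_betw_cong)
qed

lemma translation_mult:
  assumes "g \<in> Units G" "h \<in> Units G"
  shows "\<rho> (g \<otimes> h) = \<rho> g \<otimes>\<^bsub>Q\<^esub> \<rho> h"
proof -
  have "\<rho> g \<otimes>\<^bsub>Q\<^esub> \<rho> h = compose \<Omega> (\<rho> h) (\<rho> g)"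
    using assms right_sym_group_simps(3)[OF translation_Bij translation_Bij]
    by (simp add: unit_translations_def)
  also have "\<dots> = \<rho> (g \<otimes> h)"
    using assms mult_unit_closed \<Omega>_carrier
    by (auto simp: compose_def right_translation_def m_assoc Units_closed subset_iff intro!: restrict_ext)
  finally show ?thesis ..
qed

lemma group_unit_translations: "group Q"
proof -
  interpret U: group "units_of G" by (rule units_group)
  interpret R: group "right_sym_group \<Omega>" by (rule group_right_sym_group)
  interpret group_hom "units_of G" "right_sym_group \<Omega>" \<rho>
    using translation_mult translation_Bij
    by unfold_locales
      (auto simp: hom_def units_of_carrier units_of_mult right_sym_group_simps unit_translations_def)
  show ?thesis
    using R.subgroup_imp_group[OF img_is_subgroup]
    by (simp add: unit_translations_def units_of_carrier)
qed

sublocale Q: group Q by (rule group_unit_translations)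

lemma carrier_unit_translations: "carrier Q = \<rho> ` Units G"
  by (simp add: unit_translations_def)

lemma unit_translations_Bij: "\<sigma> \<in> carrier Q \<Longrightarrow> \<sigma> \<in> Bij \<Omega>"
  using translation_Bij by (auto simp: carrier_unit_translations)

lemma unit_translations_mult_apply:
  assumes "\<sigma> \<in> carrier Q" "\<tau> \<in> carrier Q" "x \<in> \<Omega>"
  shows "(\<sigma> \<otimes>\<^bsub>Q\<^esub> \<tau>) x = \<tau> (\<sigma> x)"
  using assms right_sym_group_simps(3)[OF unit_translations_Bij unit_translations_Bij, of \<sigma> \<tau>]
  by (simp add: unit_translations_def compose_eq)

lemma unit_translations_one_apply: "x \<in> \<Omega> \<Longrightarrow> \<one>\<^bsub>Q\<^esub> x = x"
  by (simp add: unit_translations_def right_sym_group_simps)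

lemma unit_translations_closed:
  assumes "\<sigma> \<in> carrier Q" "x \<in> \<Omega>"
  shows "\<sigma> x \<in> \<Omega>"
  using assms unit_translations_Bij Bij_imp_funcset by blast

lemma unit_translations_inj:
  assumes "\<sigma> \<in> carrier Q" "x \<in> \<Omega>" "y \<in> \<Omega>" "\<sigma> x = \<sigma> y"
  shows "x = y"
  using assms unit_translations_Bij[of \<sigma>] by (auto simp: Bij_def bij_betw_def inj_on_def)

lemma unit_translations_inv_apply:
  assumes "\<sigma> \<in> carrier Q" "x \<in> \<Omega>"
  shows "\<sigma> ((inv\<^bsub>Q\<^esub> \<sigma>) x) = x" "(inv\<^bsub>Q\<^esub> \<sigma>) (\<sigma> x) = x"
  using assms unit_translations_mult_apply[of "inv\<^bsub>Q\<^esub> \<sigma>" \<sigma> x]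
    unit_translations_mult_apply[of \<sigma> "inv\<^bsub>Q\<^esub> \<sigma>" x] unit_translations_one_apply
  by simp_all

lemma unit_translations_mult_left:
  assumes "\<sigma> \<in> carrier Q" "x \<in> \<Omega>" "m \<in> carrier G" "m \<otimes> x \<in> \<Omega>"
  shows "\<sigma> (m \<otimes> x) = m \<otimes> \<sigma> x"
  using assms \<Omega>_carrier
  by (auto simp: carrier_unit_translations right_translation_def m_assoc Units_closed subset_iff)

lemma unit_translations_green_L:
  assumes "\<sigma> \<in> carrier Q" "x \<in> \<Omega>" "y \<in> \<Omega>" "(x, y) \<in> green_L G"
  shows "(\<sigma> x, \<sigma> y) \<in> green_L G"
  using assms green_L_mult_right
  by (auto simp: carrier_unit_translations right_translation_def Units_closed)

lemma unit_translations_green_R: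
  assumes "\<sigma> \<in> carrier Q" "x \<in> \<Omega>"
  shows "(x, \<sigma> x) \<in> green_R G"
  using assms green_R_mult_unit \<Omega>_carrier
  by (auto simp: carrier_unit_translations right_translation_def)

end


text \<open>
  The subgroup \<open>S\<close> of those translations that fix every \<open>\<L>\<close>-class in \<open>\<Omega>\<close> has finite index,
  because \<open>Q\<close> permutes these finitely many classes. Choose a point \<open>b L\<close> in each class \<open>L\<close>. An
  element of \<open>S\<close> maps the \<open>\<H>\<close>-class of \<open>b L\<close> to itself, as right translation by a unit also
  preserves \<open>\<R>\<close>-classes, and its value at \<open>b L\<close> determines it on \<open>L\<close>. So restriction embeds \<open>S\<close>
  in the product of the Schuetzenberger groups at the points \<open>b L\<close>.
\<close>
theorem (in translated_set) folner_group_unit_translations: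
  assumes D_closed: "\<And>x y. \<lbrakk>x \<in> \<Omega>; (x, y) \<in> green_D G\<rbrakk> \<Longrightarrow> y \<in> \<Omega>"
    and fin: "finite {L \<in> carrier G // green_L G. L \<subseteq> \<Omega>}"
    and folner: "\<And>H. \<lbrakk>H \<in> carrier G // green_H G; H \<subseteq> \<Omega>\<rbrakk> \<Longrightarrow>
      folner_group (schutzenberger_group G H)"
  shows "folner_group Q"
proof -
  define \<L> where "\<L> = {L \<in> carrier G // green_L G. L \<subseteq> \<Omega>}"
  have fin_\<L>: "finite \<L>" using fin by (simp add: \<L>_def)
  have refl_L: "(x, x) \<in> green_L G" if "x \<in> \<Omega>" for x
    using that \<Omega>_carrier by (auto simp: green_L_def)
  have sym_L: "(y, x) \<in> green_L G" if "(x, y) \<in> green_L G" for x y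
    using that by (auto simp: green_L_def)
  have trans_L: "(x, z) \<in> green_L G" if "(x, y) \<in> green_L G" "(y, z) \<in> green_L G" for x y z
    using that by (auto simp: green_L_def)
  have L_class: "green_L G `` {x} \<in> \<L>" if "x \<in> \<Omega>" for x
    using that \<Omega>_carrier D_closed green_L_subset_green_D by (auto simp: \<L>_def intro!: quotientI)
  have "\<exists>b. b \<in> L" if "L \<in> \<L>" for L
    using that equiv_green_L[of G] in_quotient_imp_non_empty by (fastforce simp: \<L>_def)
  then obtain b where b: "\<And>L. L \<in> \<L> \<Longrightarrow> b L \<in> L" by metis
  have b\<Omega>: "b L \<in> \<Omega>" if "L \<in> \<L>" for L using that b by (auto simp: \<L>_def)
  have rel_b: "(x, b (green_L G `` {x})) \<in> green_L G" if "x \<in> \<Omega>" for x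
    using b[OF L_class[OF that]] by simp
  define S where "S = {\<sigma> \<in> carrier Q. \<forall>x\<in>\<Omega>. (\<sigma> x, x) \<in> green_L G}"
  have S: "subgroup S Q"
  proof (rule Q.subgroupI)
    show "S \<subseteq> carrier Q" by (auto simp: S_def)
    have "\<one>\<^bsub>Q\<^esub> \<in> S" using unit_translations_one_apply refl_L by (simp add: S_def)
    then show "S \<noteq> {}" by blast
  next
    fix \<sigma> assume \<sigma>: "\<sigma> \<in> S"
    then have \<sigma>Q: "\<sigma> \<in> carrier Q" by (simp add: S_def)
    have "((inv\<^bsub>Q\<^esub> \<sigma>) x, x) \<in> green_L G" if x: "x \<in> \<Omega>" for x
    proof -
      have "(inv\<^bsub>Q\<^esub> \<sigma>) x \<in> \<Omega>" using unit_translations_closed \<sigma>Q x by simp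
      then have "(\<sigma> ((inv\<^bsub>Q\<^esub> \<sigma>) x), (inv\<^bsub>Q\<^esub> \<sigma>) x) \<in> green_L G" using \<sigma> by (auto simp: S_def)
      then show ?thesis using unit_translations_inv_apply(1)[OF \<sigma>Q x] sym_L by simp
    qed
    then show "inv\<^bsub>Q\<^esub> \<sigma> \<in> S" using \<sigma>Q by (simp add: S_def)
  next
    fix \<sigma> \<tau> assume st: "\<sigma> \<in> S" "\<tau> \<in> S"
    have "(\<tau> (\<sigma> x), x) \<in> green_L G" if x: "x \<in> \<Omega>" for x
    proof -
      have "\<sigma> x \<in> \<Omega>" using st x by (simp add: S_def unit_translations_closed)
      then show ?thesis using st x trans_L[of "\<tau> (\<sigma> x)" "\<sigma> x" x] by (simp add: S_def)
    qed
    then show "\<sigma> \<otimes>\<^bsub>Q\<^esub> \<tau> \<in> S" using st by (simp add: S_def unit_translations_mult_apply)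
  qed
  interpret S: subgroup S Q by (rule S)
  \<comment> \<open>\<open>\<phi> \<sigma>\<close> is the permutation of the \<open>\<L>\<close>-classes that \<open>\<sigma>\<close> induces; it determines the left
    coset of \<open>\<sigma>\<close> modulo \<open>S\<close>.\<close>
  define \<phi> where "\<phi> \<sigma> = (\<lambda>L\<in>\<L>. green_L G `` {\<sigma> (b L)})" for \<sigma>
  have "\<phi> ` carrier Q \<subseteq> \<L> \<rightarrow>\<^sub>E \<L>"
    using L_class b\<Omega> unit_translations_closed by (auto simp: \<phi>_def)
  then have fin_\<phi>: "finite (\<phi> ` carrier Q)"
    by (rule finite_subset) (intro finite_PiE fin_\<L>)
  have coset_eq: "\<sigma> <#\<^bsub>Q\<^esub> S = \<tau> <#\<^bsub>Q\<^esub> S"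
    if st: "\<sigma> \<in> carrier Q" "\<tau> \<in> carrier Q" and eq: "\<phi> \<sigma> = \<phi> \<tau>" for \<sigma> \<tau>
  proof -
    have "((inv\<^bsub>Q\<^esub> \<sigma> \<otimes>\<^bsub>Q\<^esub> \<tau>) x, x) \<in> green_L G" if x: "x \<in> \<Omega>" for x
    proof -
      define y where "y = (inv\<^bsub>Q\<^esub> \<sigma>) x"
      have y: "y \<in> \<Omega>" using st x by (simp add: y_def unit_translations_closed)
      define L where "L = green_L G `` {y}"
      have L: "L \<in> \<L>" and yb: "(y, b L) \<in> green_L G" using L_class rel_b y by (auto simp: L_def)
      have "green_L G `` {\<sigma> (b L)} = green_L G `` {\<tau> (b L)}"
        using fun_cong[OF eq, of L] L by (simp add: \<phi>_def)
      moreover have "\<sigma> (b L) \<in> green_L G `` {\<sigma> (b L)}"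
        by (intro ImageI[OF _ singletonI] refl_L unit_translations_closed[OF st(1)] b\<Omega>[OF L])
      ultimately have \<tau>\<sigma>: "(\<tau> (b L), \<sigma> (b L)) \<in> green_L G" by simp
      have "(\<tau> y, \<sigma> y) \<in> green_L G"
        by (rule trans_L[OF unit_translations_green_L[OF st(2) y b\<Omega>[OF L] yb]
              trans_L[OF \<tau>\<sigma> sym_L[OF unit_translations_green_L[OF st(1) y b\<Omega>[OF L] yb]]]])
      moreover have "(inv\<^bsub>Q\<^esub> \<sigma> \<otimes>\<^bsub>Q\<^esub> \<tau>) x = \<tau> y"
        unfolding y_def by (intro unit_translations_mult_apply Q.inv_closed st x)
      moreover have "\<sigma> y = x" unfolding y_def by (rule unit_translations_inv_apply(1)[OF st(1) x])
      ultimately show ?thesis by metis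
    qed
    moreover have "inv\<^bsub>Q\<^esub> \<sigma> \<otimes>\<^bsub>Q\<^esub> \<tau> \<in> carrier Q" using st by simp
    ultimately have "inv\<^bsub>Q\<^esub> \<sigma> \<otimes>\<^bsub>Q\<^esub> \<tau> \<in> S" unfolding S_def by blast
    then have "\<tau> \<in> \<sigma> <#\<^bsub>Q\<^esub> S" using st by (intro S.lcos_module_rev Q.is_group)
    then show ?thesis using st S by (intro Q.l_repr_independence)
  qed
  have "(\<lambda>\<sigma>. \<sigma> <#\<^bsub>Q\<^esub> S) ` carrier Q \<subseteq>
      (\<lambda>c. inv_into (carrier Q) \<phi> c <#\<^bsub>Q\<^esub> S) ` \<phi> ` carrier Q"
  proof (rule image_subsetI)
    fix \<sigma> assume \<sigma>: "\<sigma> \<in> carrier Q"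
    then have "\<sigma> <#\<^bsub>Q\<^esub> S = inv_into (carrier Q) \<phi> (\<phi> \<sigma>) <#\<^bsub>Q\<^esub> S"
      by (intro coset_eq) (auto simp: inv_into_into f_inv_into_f)
    with \<sigma> show "\<sigma> <#\<^bsub>Q\<^esub> S \<in> (\<lambda>c. inv_into (carrier Q) \<phi> c <#\<^bsub>Q\<^esub> S) ` \<phi> ` carrier Q" by blast
  qed
  then have index: "finite ((\<lambda>\<sigma>. \<sigma> <#\<^bsub>Q\<^esub> S) ` carrier Q)"
    using fin_\<phi> finite_subset by blast
  define H where "H L = green_H G `` {b L}" for L
  have H: "H L \<in> carrier G // green_H G" "H L \<subseteq> \<Omega>" "b L \<in> H L" if L: "L \<in> \<L>" for L
  proof -
    have bL: "b L \<in> carrier G" using b\<Omega>[OF L] \<Omega>_carrier by blast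
    then show "H L \<in> carrier G // green_H G" unfolding H_def by (rule quotientI)
    show "b L \<in> H L" using bL by (simp add: H_def green_H_def green_L_def green_R_def)
    show "H L \<subseteq> \<Omega>"
    proof
      fix x assume "x \<in> H L"
      then have "(b L, x) \<in> green_D G"
        using green_L_subset_green_D by (auto simp: H_def green_H_def)
      then show "x \<in> \<Omega>" by (rule D_closed[OF b\<Omega>[OF L]])
    qed
  qed
  define \<Gamma> where "\<Gamma> L = schutzenberger_group G (H L)" for L
  define h where "h \<sigma> = (\<lambda>L\<in>\<L>. restrict \<sigma> (H L))" for \<sigma> :: "'a \<Rightarrow> 'a"
  have closed_H: "\<sigma> x \<in> H L" if \<sigma>: "\<sigma> \<in> S" and L: "L \<in> \<L>" and x: "x \<in> H L" for \<sigma> L x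
  proof -
    have x\<Omega>: "x \<in> \<Omega>" using x H(2)[OF L] by blast
    have "\<sigma> \<in> carrier Q" "(\<sigma> x, x) \<in> green_L G" using \<sigma> x\<Omega> unfolding S_def by blast+
    moreover from this have "(x, \<sigma> x) \<in> green_R G" using x\<Omega> by (intro unit_translations_green_R)
    moreover have "(b L, x) \<in> green_L G" "(b L, x) \<in> green_R G"
      using x by (simp_all add: H_def green_H_def)
    ultimately show ?thesis by (simp add: H_def green_H_def green_L_def green_R_def)
  qed
  have restrict_\<Gamma>: "restrict \<sigma> (H L) \<in> carrier (\<Gamma> L)"
    and restrict_Bij: "restrict \<sigma> (H L) \<in> Bij (H L)"
    if \<sigma>: "\<sigma> \<in> S" and L: "L \<in> \<L>" for \<sigma> L
  proof -
    have \<sigma>Q: "\<sigma> \<in> carrier Q" by (rule S.mem_carrier[OF \<sigma>])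
    have inv: "inv\<^bsub>Q\<^esub> \<sigma> \<in> S" by (rule S.m_inv_closed[OF \<sigma>])
    have "bij_betw \<sigma> (H L) (H L)"
    proof (rule bij_betw_byWitness[where f' = "inv\<^bsub>Q\<^esub> \<sigma>"])
      show "\<forall>x\<in>H L. (inv\<^bsub>Q\<^esub> \<sigma>) (\<sigma> x) = x" "\<forall>x\<in>H L. \<sigma> ((inv\<^bsub>Q\<^esub> \<sigma>) x) = x"
        by (rule ballI, rule unit_translations_inv_apply[OF \<sigma>Q], rule subsetD[OF H(2)[OF L]], assumption)+
      show "\<sigma> ` H L \<subseteq> H L" "(inv\<^bsub>Q\<^esub> \<sigma>) ` H L \<subseteq> H L"
        by (rule image_subsetI, rule closed_H[OF \<sigma> L] closed_H[OF inv L], assumption)+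
    qed
    then show Bij: "restrict \<sigma> (H L) \<in> Bij (H L)" by (simp add: Bij_def cong: bij_betw_cong)
    obtain g where g: "g \<in> Units G" "\<sigma> = \<rho> g" using \<sigma>Q by (auto simp: carrier_unit_translations)
    then have "\<forall>x\<in>H L. restrict \<sigma> (H L) x = x \<otimes> g"
      using H(2)[OF L] by (auto simp: right_translation_def)
    then show "restrict \<sigma> (H L) \<in> carrier (\<Gamma> L)"
      using Bij g(1) by (auto simp: \<Gamma>_def schutzenberger_group_def right_sym_group_simps)
  qed
  have "h \<in> hom (Q\<lparr>carrier := S\<rparr>) (product_group \<L> \<Gamma>)"
  proof (rule homI)
    fix \<sigma> \<tau> assume "\<sigma> \<in> carrier (Q\<lparr>carrier := S\<rparr>)" "\<tau> \<in> carrier (Q\<lparr>carrier := S\<rparr>)"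
    then have st: "\<sigma> \<in> S" "\<tau> \<in> S" by simp_all
    have "restrict (\<sigma> \<otimes>\<^bsub>Q\<^esub> \<tau>) (H L) = restrict \<sigma> (H L) \<otimes>\<^bsub>\<Gamma> L\<^esub> restrict \<tau> (H L)" if L: "L \<in> \<L>" for L
    proof -
      have "restrict \<sigma> (H L) \<otimes>\<^bsub>\<Gamma> L\<^esub> restrict \<tau> (H L) = compose (H L) (restrict \<tau> (H L)) (restrict \<sigma> (H L))"
        using right_sym_group_simps(3)[OF restrict_Bij restrict_Bij] st L
        by (simp add: \<Gamma>_def schutzenberger_group_def)
      also have "\<dots> = restrict (\<sigma> \<otimes>\<^bsub>Q\<^esub> \<tau>) (H L)"
        unfolding compose_def
      proof (rule restrict_ext)
        fix x assume x: "x \<in> H L"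
        then show "restrict \<tau> (H L) (restrict \<sigma> (H L) x) = (\<sigma> \<otimes>\<^bsub>Q\<^esub> \<tau>) x"
          using closed_H[OF st(1) L x] H(2)[OF L] S.mem_carrier st
          by (simp add: unit_translations_mult_apply[of \<sigma> \<tau> x] subset_iff)
      qed
      finally show ?thesis ..
    qed
    then show "h (\<sigma> \<otimes>\<^bsub>Q\<lparr>carrier := S\<rparr>\<^esub> \<tau>) = h \<sigma> \<otimes>\<^bsub>product_group \<L> \<Gamma>\<^esub> h \<tau>"
      by (auto simp: h_def intro!: restrict_ext)
  qed (use restrict_\<Gamma> in \<open>auto simp: h_def\<close>)
  moreover have "inj_on h (carrier (Q\<lparr>carrier := S\<rparr>))"
  proof (rule inj_onI)
    fix \<sigma> \<tau> assume st: "\<sigma> \<in> carrier (Q\<lparr>carrier := S\<rparr>)" "\<tau> \<in> carrier (Q\<lparr>carrier := S\<rparr>)" and eq: "h \<sigma> = h \<tau>"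
    have stQ: "\<sigma> \<in> carrier Q" "\<tau> \<in> carrier Q" using st S.mem_carrier by simp_all
    have "\<sigma> x = \<tau> x" if x: "x \<in> \<Omega>" for x
    proof -
      define L where "L = green_L G `` {x}"
      have L: "L \<in> \<L>" and xb: "(x, b L) \<in> green_L G" using L_class rel_b x by (auto simp: L_def)
      obtain a where a: "a \<in> carrier G" "x = a \<otimes> b L" using xb unfolding green_L_iff by blast
      have "\<sigma> (b L) = \<tau> (b L)"
        using fun_cong[OF fun_cong[OF eq, of L], of "b L"] L H(3)[OF L] by (simp add: h_def)
      then show ?thesis
        using unit_translations_mult_left[OF stQ(1) b\<Omega>[OF L] a(1)]
          unit_translations_mult_left[OF stQ(2) b\<Omega>[OF L] a(1)] a x by simp
    qed
    then show "\<sigma> = \<tau>"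
      using stQ[THEN unit_translations_Bij, THEN Bij_imp_extensional] by (intro extensionalityI)
  qed
  moreover have group_\<Gamma>: "group (\<Gamma> L)" if "L \<in> \<L>" for L
    using H(1)[OF that] by (simp add: \<Gamma>_def group_schutzenberger_group)
  moreover have "folner_group (product_group \<L> \<Gamma>)"
    using fin H folner by (intro folner_group_product) (auto simp: \<L>_def \<Gamma>_def)
  ultimately have "folner_group (Q\<lparr>carrier := S\<rparr>)"
    using S.subgroup_is_group[OF Q.is_group] by (intro folner_group_if_inj_hom[of _ "product_group \<L> \<Gamma>" h] product_group)
  then show ?thesis using S index by (intro Q.folner_group_if_finite_index)
qed


section \<open>Almost actions from good points\<close>

text \<open>
  All conditions that hold for most points can be checked on a single large set of good points.
\<close>
lemma almost_action_if_good_points: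
  assumes X: "finite X" "X \<noteq> {}" and act: "act \<in> carrier M \<rightarrow> X \<rightarrow> X"
    and one: "\<And>x. x \<in> X \<Longrightarrow> act \<one>\<^bsub>M\<^esub> x = x"
    and good: "good \<subseteq> X" "real (card (X - good)) \<le> \<epsilon> * real (card X)"
    and mult: "\<And>g h x. \<lbrakk>g \<in> K; h \<in> K; x \<in> good\<rbrakk> \<Longrightarrow> act g (act h x) = act (g \<otimes>\<^bsub>M\<^esub> h) x"
    and separate: "\<And>g h x. \<lbrakk>g \<in> K; h \<in> K; g \<noteq> h; x \<in> good\<rbrakk> \<Longrightarrow> act g x \<noteq> act h x"
  shows "almost_action M K \<epsilon> X act"
proof -
  have pos: "real (card X) > 0" using X by (simp add: card_gt_0_iff)
  have good_card: "real (card good) = real (card X) - real (card (X - good))"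
    using X good by (simp add: card_Diff_subset card_mono finite_subset of_nat_diff)
  have "real (card {x\<in>X. act g (act h x) = act (g \<otimes>\<^bsub>M\<^esub> h) x}) / real (card X) \<ge> 1 - \<epsilon>"
    if "g \<in> K" "h \<in> K" for g h
  proof -
    have "card good \<le> card {x\<in>X. act g (act h x) = act (g \<otimes>\<^bsub>M\<^esub> h) x}"
      using X good(1) mult[OF that] by (intro card_mono) auto
    then have "(1 - \<epsilon>) * real (card X) \<le> real (card {x\<in>X. act g (act h x) = act (g \<otimes>\<^bsub>M\<^esub> h) x})"
      using good_card good(2) by (simp add: algebra_simps)
    then show ?thesis using pos by (simp add: field_simps)
  qed
  moreover have "real (card {x\<in>X. act g x = act h x}) / real (card X) \<le> \<epsilon>"
    if "g \<in> K" "h \<in> K" "g \<noteq> h" for g h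
  proof -
    have "card {x\<in>X. act g x = act h x} \<le> card (X - good)"
      using X separate[OF that] by (intro card_mono) auto
    then have "real (card {x\<in>X. act g x = act h x}) \<le> \<epsilon> * real (card X)" using good(2) by simp
    then show ?thesis using pos by (simp add: field_simps)
  qed
  ultimately show ?thesis using act one by (simp add: almost_action_def)
qed

lemma almost_action_transport:
  assumes \<beta>: "bij_betw \<beta> X Y" and act: "almost_action M K \<epsilon> X act"
    and K: "K \<subseteq> carrier M" "monoid M"
  shows "almost_action M K \<epsilon> Y (\<lambda>m y. \<beta> (act m (inv_into X \<beta> y)))"
    (is "almost_action M K \<epsilon> Y ?act")
proof -
  interpret monoid M by fact
  have in_X: "inv_into X \<beta> y \<in> X" if "y \<in> Y" for y
    using \<beta> that by (metis bij_betw_def inv_into_into)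
  have in_Y: "\<beta> x \<in> Y" if "x \<in> X" for x using \<beta> that by (auto simp: bij_betw_def)
  have \<beta>inv: "\<beta> (inv_into X \<beta> y) = y" if "y \<in> Y" for y
    using \<beta> that by (metis bij_betw_def f_inv_into_f)
  have inv\<beta>: "inv_into X \<beta> (\<beta> x) = x" if "x \<in> X" for x
    using \<beta> that by (metis bij_betw_def inv_into_f_f)
  have inj: "\<beta> x = \<beta> y \<longleftrightarrow> x = y" if "x \<in> X" "y \<in> X" for x y
    using inv\<beta> that by metis
  have closed: "act m x \<in> X" if "m \<in> carrier M" "x \<in> X" for m x
    using act that by (auto simp: almost_action_def Pi_iff)
  have card_eq: "card {y \<in> Y. P y} = card {x \<in> X. P (\<beta> x)}" for P
  proof -
    have "bij_betw \<beta> {x \<in> X. P (\<beta> x)} {y \<in> Y. P y}"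
      using \<beta> by (auto simp: bij_betw_def inj_on_def)
    then show ?thesis using bij_betw_same_card by metis
  qed
  have cXY: "card Y = card X" using \<beta> bij_betw_same_card by metis
  have "{x \<in> X. ?act g (?act h (\<beta> x)) = ?act (g \<otimes>\<^bsub>M\<^esub> h) (\<beta> x)} =
      {x \<in> X. act g (act h x) = act (g \<otimes>\<^bsub>M\<^esub> h) x}" if "g \<in> K" "h \<in> K" for g h
  proof -
    have "g \<in> carrier M" "h \<in> carrier M" using that K by auto
    then show ?thesis by (auto simp: inv\<beta> inj closed)
  qed
  moreover have "{x \<in> X. ?act g (\<beta> x) = ?act h (\<beta> x)} = {x \<in> X. act g x = act h x}"
    if "g \<in> K" "h \<in> K" for g h
  proof -
    have "g \<in> carrier M" "h \<in> carrier M" using that K by auto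
    then show ?thesis by (auto simp: inv\<beta> inj closed)
  qed
  moreover have "?act \<in> carrier M \<rightarrow> Y \<rightarrow> Y" using in_X in_Y closed by blast
  moreover have "\<forall>y\<in>Y. ?act \<one>\<^bsub>M\<^esub> y = y"
    using act in_X \<beta>inv by (simp add: almost_action_def)
  ultimately show ?thesis
    using act by (simp add: almost_action_def card_eq cXY)
qed

text \<open>
  A union bound over all pairs from \<open>K\<close> collects the exceptional points of all Hamming distances
  into one small set.
\<close>
lemma sofic_groupE_good_points:
  fixes G (structure)
  assumes G: "sofic_group G" and K: "finite K" "K \<subseteq> carrier G" and \<delta>: "0 < \<delta>"
  obtains X :: "nat set" and \<phi> where "finite X" "X \<noteq> {}" "\<phi> \<in> carrier G \<rightarrow> Bij X"
    "real (card {x \<in> X. \<not> (\<forall>g\<in>K. \<forall>h\<in>K. \<phi> (g \<otimes> h) x = \<phi> g (\<phi> h x) \<and> (g \<noteq> h \<longrightarrow> \<phi> g x \<noteq> \<phi> h x))})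
      \<le> \<delta> * real (card X)"
proof -
  define \<epsilon> where "\<epsilon> = \<delta> / (2 * real (card (K \<times> K)) + 1)"
  have \<epsilon>: "0 < \<epsilon>" using \<delta> by (simp add: \<epsilon>_def add_nonneg_pos)
  have "\<exists>(X :: nat set) \<phi>. finite X \<and> X \<noteq> {} \<and> almost_hom G K \<epsilon> X \<phi>"
    using G K \<epsilon> by (simp add: sofic_group_def)
  then obtain X :: "nat set" and \<phi> where X: "finite X" "X \<noteq> {}" and hom: "almost_hom G K \<epsilon> X \<phi>"
    by blast
  have \<phi>: "\<phi> g \<in> Bij X" if "g \<in> carrier G" for g
    using hom that by (auto simp: almost_hom_def BijGroup_def Pi_iff)
  interpret group G using G by (simp add: sofic_group_def)
  have pos: "real (card X) > 0" using X by (simp add: card_gt_0_iff)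
  define A where "A p = {x \<in> X. \<phi> (fst p \<otimes> snd p) x \<noteq> \<phi> (fst p) (\<phi> (snd p) x)}" for p
  define B where "B p = {x \<in> X. fst p \<noteq> snd p \<and> \<phi> (fst p) x = \<phi> (snd p) x}" for p
  have A: "real (card (A p)) \<le> \<epsilon> * real (card X)" if p: "p \<in> K \<times> K" for p
  proof -
    have "fst p \<in> carrier G" "snd p \<in> carrier G" using p K by auto
    then have "A p = {x \<in> X. \<phi> (fst p \<otimes> snd p) x \<noteq> (\<phi> (fst p) \<otimes>\<^bsub>BijGroup X\<^esub> \<phi> (snd p)) x}"
      using \<phi> by (auto simp: A_def BijGroup_def compose_eq)
    moreover have "hamming_dist X (\<phi> (fst p \<otimes> snd p)) (\<phi> (fst p) \<otimes>\<^bsub>BijGroup X\<^esub> \<phi> (snd p)) \<le> \<epsilon>"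
      using hom p by (auto simp: almost_hom_def)
    ultimately show ?thesis using pos by (simp add: hamming_dist_def field_simps)
  qed
  have B: "real (card (B p)) \<le> \<epsilon> * real (card X)" if p: "p \<in> K \<times> K" for p
  proof (cases "fst p = snd p")
    case True
    then show ?thesis using \<epsilon> by (simp add: B_def)
  next
    case False
    have "hamming_dist X (\<phi> (fst p)) (\<phi> (snd p)) \<ge> 1 - \<epsilon>"
      using hom p False by (auto simp: almost_hom_def)
    then have "real (card {x \<in> X. \<phi> (fst p) x \<noteq> \<phi> (snd p) x}) \<ge> (1 - \<epsilon>) * real (card X)"
      using pos by (simp add: hamming_dist_def field_simps)
    moreover have "card X = card (B p) + card {x \<in> X. \<phi> (fst p) x \<noteq> \<phi> (snd p) x}"
    proof -
      have "X = B p \<union> {x \<in> X. \<phi> (fst p) x \<noteq> \<phi> (snd p) x}" using False by (auto simp: B_def)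
      moreover have "B p \<inter> {x \<in> X. \<phi> (fst p) x \<noteq> \<phi> (snd p) x} = {}" by (auto simp: B_def)
      ultimately show ?thesis using X(1) card_Un_disjoint by (metis (no_types, lifting) finite_Un)
    qed
    ultimately show ?thesis by (simp add: algebra_simps)
  qed
  have sub: "{x \<in> X. \<not> (\<forall>g\<in>K. \<forall>h\<in>K. \<phi> (g \<otimes> h) x = \<phi> g (\<phi> h x) \<and> (g \<noteq> h \<longrightarrow> \<phi> g x \<noteq> \<phi> h x))}
      \<subseteq> (\<Union>p\<in>K \<times> K. A p \<union> B p)" (is "?bad \<subseteq> ?U") by (auto simp: A_def B_def)
  have fin: "finite (K \<times> K)" using K by simp
  have "card ?bad \<le> card ?U"
    using X fin by (intro card_mono sub) (auto simp: A_def B_def)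
  also have "\<dots> \<le> (\<Sum>p\<in>K \<times> K. card (A p \<union> B p))" by (rule card_UN_le[OF fin])
  also have "\<dots> \<le> (\<Sum>p\<in>K \<times> K. card (A p) + card (B p))" by (intro sum_mono card_Un_le)
  finally have "real (card ?bad) \<le> (\<Sum>p\<in>K \<times> K. real (card (A p)) + real (card (B p)))"
    by (simp flip: of_nat_add of_nat_sum)
  also have "\<dots> \<le> real (card (K \<times> K)) * (\<epsilon> * real (card X) + \<epsilon> * real (card X))"
    by (intro sum_bounded_above add_mono A B)
  also have "\<dots> = (2 * real (card (K \<times> K)) * \<epsilon>) * real (card X)" by (simp add: algebra_simps)
  also have "\<dots> \<le> \<delta> * real (card X)"
  proof (intro mult_right_mono)
    have "(2 * real (card (K \<times> K)) + 1) * \<epsilon> = \<delta>"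
      unfolding \<epsilon>_def by (simp add: add_nonneg_eq_0_iff)
    then show "2 * real (card (K \<times> K)) * \<epsilon> \<le> \<delta>" using \<epsilon> by (simp add: algebra_simps)
  qed simp
  finally show ?thesis using X \<phi> by (intro that) auto
qed


section \<open>Sofic monoids from Foelner sets of translations\<close>

text \<open>
  The action on \<open>X \<times> F \<times> C\<close> and \<open>Y\<close> described at the beginning, where \<open>C\<close> counts the copies. Where
  that description does not apply, the point or coordinate concerned is left unchanged. The points of
  \<open>X \<times> F \<times> C\<close> with good coordinates in \<open>X\<close> and \<open>F\<close> satisfy all requirements exactly.
\<close>
theorem (in directly_finite_monoid) sofic_if_folner_unit_translations:
  assumes units: "sofic_group (units_of G)"
    and folner: "\<And>N. \<lbrakk>finite N; N \<subseteq> carrier G - Units G\<rbrakk> \<Longrightarrow>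
      \<exists>\<Omega>. N \<subseteq> \<Omega> \<and> translated_set G \<Omega> \<and> folner_group (unit_translations G \<Omega>)"
  shows "sofic_monoid G"
proof -
  have "\<exists>(X :: nat set) act. finite X \<and> X \<noteq> {} \<and> almost_action G K \<epsilon> X act"
    if K: "finite K" "K \<subseteq> carrier G" and \<epsilon>: "0 < \<epsilon>" for K and \<epsilon> :: real
  proof -
    define K' where "K' = insert \<one> (K \<union> (\<lambda>(g, h). g \<otimes> h) ` (K \<times> K))"
    define U where "U = K' \<inter> Units G"
    define N where "N = K' - Units G"
    have K': "finite K'" "K' \<subseteq> carrier G" using K by (auto simp: K'_def)
    have K'I: "\<one> \<in> K'" "\<And>g. g \<in> K \<Longrightarrow> g \<in> K'" "\<And>g h. g \<in> K \<Longrightarrow> h \<in> K \<Longrightarrow> g \<otimes> h \<in> K'"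
      by (auto simp: K'_def)
    have U: "finite U" "U \<subseteq> Units G" "\<one> \<in> U" and N: "finite N" "N \<subseteq> carrier G - Units G"
      using K' K'I(1) by (auto simp: U_def N_def)
    obtain \<Omega> where \<Omega>: "N \<subseteq> \<Omega>" "translated_set G \<Omega>" "folner_group (unit_translations G \<Omega>)"
      using folner[OF N] by blast
    interpret translated_set G \<Omega> by (rule \<Omega>(2))
    have \<rho>Q: "\<rho> u \<in> carrier Q" if "u \<in> Units G" for u using that by (simp add: carrier_unit_translations)
    have N\<Omega>: "n \<in> \<Omega>" if "n \<in> N" for n using \<Omega>(1) that by blast

    have \<delta>: "0 < \<epsilon> / 4" using \<epsilon> by simp
    have U_carrier: "U \<subseteq> carrier (units_of G)" using U by (simp add: units_of_carrier)
    obtain X :: "nat set" and \<phi> where X: "finite X" "X \<noteq> {}"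
      and \<phi>_Bij: "\<phi> \<in> carrier (units_of G) \<rightarrow> Bij X"
      and X_bad: "real (card {x \<in> X. \<not> (\<forall>g\<in>U. \<forall>h\<in>U.
        \<phi> (g \<otimes>\<^bsub>units_of G\<^esub> h) x = \<phi> g (\<phi> h x) \<and> (g \<noteq> h \<longrightarrow> \<phi> g x \<noteq> \<phi> h x))})
        \<le> \<epsilon> / 4 * real (card X)"
      by (rule sofic_groupE_good_points[OF units U(1) U_carrier \<delta>])
    define X_good where "X_good = {x \<in> X. \<forall>g\<in>U. \<forall>h\<in>U.
        \<phi> (g \<otimes> h) x = \<phi> g (\<phi> h x) \<and> (g \<noteq> h \<longrightarrow> \<phi> g x \<noteq> \<phi> h x)}"
    have "X - X_good = {x \<in> X. \<not> (\<forall>g\<in>U. \<forall>h\<in>U.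
        \<phi> (g \<otimes>\<^bsub>units_of G\<^esub> h) x = \<phi> g (\<phi> h x) \<and> (g \<noteq> h \<longrightarrow> \<phi> g x \<noteq> \<phi> h x))}"
      unfolding X_good_def units_of_mult by blast
    then have X_bad: "real (card (X - X_good)) \<le> \<epsilon> / 4 * real (card X)" using X_bad by (simp only:)
    have \<phi>_closed: "\<phi> g x \<in> X" if "g \<in> Units G" "x \<in> X" for g x
      using funcset_mem[OF \<phi>_Bij, of g] Bij_imp_funcset[of "\<phi> g" X] that by (auto simp: units_of_carrier)
    \<comment> \<open>An almost homomorphism need not map \<open>\<one>\<close> to the identity, whereas an almost action must;
      on good points the two agree, by injectivity of \<open>\<phi> \<one>\<close>.\<close>
    have \<phi>_one: "\<phi> \<one> x = x" if "x \<in> X_good" for x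
    proof -
      have x: "x \<in> X" "\<phi> (\<one> \<otimes> \<one>) x = \<phi> \<one> (\<phi> \<one> x)"
        using that U(3) unfolding X_good_def by blast+
      have "inj_on (\<phi> \<one>) X" using funcset_mem[OF \<phi>_Bij, of \<one>] by (simp add: units_of_carrier Bij_def bij_betw_def)
      then show ?thesis using x \<phi>_closed[of \<one> x] by (simp add: inj_on_def)
    qed

    have fin_T: "finite (\<rho> ` U)" and T_carrier: "\<rho> ` U \<subseteq> carrier Q" using U \<rho>Q by auto
    obtain F where F: "finite F" "F \<noteq> {}" "F \<subseteq> carrier Q"
      and F_bad: "real (card {q \<in> F. \<exists>t\<in>\<rho> ` U. t \<otimes>\<^bsub>Q\<^esub> q \<notin> F}) \<le> \<epsilon> / 4 * real (card F)"
      by (rule folner_groupE[OF \<Omega>(3) fin_T T_carrier \<delta>])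
    define F_good where "F_good = {q \<in> F. \<forall>u\<in>U. \<rho> u \<otimes>\<^bsub>Q\<^esub> q \<in> F}"
    have "F - F_good = {q \<in> F. \<exists>t\<in>\<rho> ` U. t \<otimes>\<^bsub>Q\<^esub> q \<notin> F}" unfolding F_good_def by blast
    then have F_bad: "real (card (F - F_good)) \<le> \<epsilon> / 4 * real (card F)" using F_bad by (simp only:)
    have FQ: "q \<in> carrier Q" if "q \<in> F" for q using F(3) that by blast

    define Y where "Y = (\<lambda>(q, n). q n) ` (F \<times> N)"
    have finY: "finite Y" using F(1) N(1) by (simp add: Y_def)
    have YI: "q n \<in> Y" if "q \<in> F" "n \<in> N" for q n using that by (auto simp: Y_def)
    have card_pos: "0 < real (card X * card F)" using X F by (simp add: card_gt_0_iff)
    obtain c :: nat where c: "real (card Y) / (\<epsilon> / 2) \<le> real c" using real_arch_simple by blast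
    \<comment> \<open>Enough copies to make \<open>Y\<close> negligible.\<close>
    define C where "C = {..c}"
    have C: "finite C" "C \<noteq> {}" "real (card Y) \<le> \<epsilon> / 2 * real (card C)"
      using c \<epsilon> by (auto simp: C_def field_simps)

    define Z :: "(nat \<times> ('a \<Rightarrow> 'a) \<times> nat + 'a) set" where "Z = Inl ` (X \<times> F \<times> C) \<union> Inr ` Y"
    define good :: "(nat \<times> ('a \<Rightarrow> 'a) \<times> nat + 'a) set" where "good = Inl ` (X_good \<times> F_good \<times> C)"
    define act :: "'a \<Rightarrow> nat \<times> ('a \<Rightarrow> 'a) \<times> nat + 'a \<Rightarrow> nat \<times> ('a \<Rightarrow> 'a) \<times> nat + 'a" where
      "act m z = (if m = \<one> then z else case z of
          Inl (x, q, i) \<Rightarrow>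
            if m \<in> Units G then Inl (\<phi> m x, if \<rho> m \<otimes>\<^bsub>Q\<^esub> q \<in> F then \<rho> m \<otimes>\<^bsub>Q\<^esub> q else q, i)
            else if m \<in> N then Inr (q m) else z
        | Inr y \<Rightarrow> if m \<otimes> y \<in> Y then Inr (m \<otimes> y) else z)" for m z
    have finZ: "finite Z" using X F C finY by (simp add: Z_def)
    have "Z \<noteq> {}" using X F C by (auto simp: Z_def)

    have act_unit: "act u (Inl (x, q, i)) = Inl (\<phi> u x, \<rho> u \<otimes>\<^bsub>Q\<^esub> q, i)"
      if "u \<in> Units G" "u \<noteq> \<one>" "\<rho> u \<otimes>\<^bsub>Q\<^esub> q \<in> F" for u x q i
      using that by (simp add: act_def)
    have act_nonunit: "act n (Inl (x, q, i)) = Inr (q n)" if "n \<in> N" for n x q i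
    proof -
      have "n \<notin> Units G" using that by (simp add: N_def)
      then have "n \<noteq> \<one>" by blast
      with \<open>n \<notin> Units G\<close> that show ?thesis by (simp add: act_def)
    qed
    have \<rho>_one: "\<rho> \<one> \<otimes>\<^bsub>Q\<^esub> q = q" if "q \<in> F" for q
    proof -
      have "\<rho> \<one> = \<one>\<^bsub>Q\<^esub>"
        using \<Omega>_carrier by (auto simp: right_translation_def unit_translations_def right_sym_group_simps
            subset_iff intro!: restrict_ext)
      then show ?thesis using FQ[OF that] by simp
    qed
    have act_good: "act u (Inl (x, q, i)) = Inl (\<phi> u x, \<rho> u \<otimes>\<^bsub>Q\<^esub> q, i)"
      if u: "u \<in> U" and x: "x \<in> X_good" and q: "q \<in> F_good" for u x q i
    proof (cases "u = \<one>")
      case True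
      then show ?thesis using \<phi>_one[OF x] \<rho>_one q by (simp add: act_def F_good_def)
    next
      case False
      then show ?thesis using u q U by (intro act_unit) (auto simp: F_good_def)
    qed

    have "almost_action G K \<epsilon> Z act"
    proof (rule almost_action_if_good_points[where good = good, OF finZ \<open>Z \<noteq> {}\<close>])
      show "act \<in> carrier G \<rightarrow> Z \<rightarrow> Z"
        using YI by (fastforce simp: act_def Z_def \<phi>_closed split: if_splits)
      show "act \<one> z = z" for z by (simp add: act_def)
      show "good \<subseteq> Z" by (auto simp: good_def Z_def X_good_def F_good_def)
      show "real (card (Z - good)) \<le> \<epsilon> * real (card Z)"
      proof -
        let ?n = "real (card X) * real (card F) * real (card C)"
        have "Z - good \<subseteq> Inl ` ((X - X_good) \<times> F \<times> C) \<union> Inl ` (X \<times> (F - F_good) \<times> C) \<union> Inr ` Y"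
          (is "_ \<subseteq> ?A \<union> ?B \<union> ?Y") by (auto simp: Z_def good_def)
        then have "card (Z - good) \<le> card (?A \<union> ?B \<union> ?Y)"
          using X F C finY by (intro card_mono) auto
        also have "\<dots> \<le> card ?A + card ?B + card ?Y"
          by (meson add_right_mono card_Un_le le_trans)
        finally have "real (card (Z - good)) \<le> real (card ?A) + real (card ?B) + real (card ?Y)"
          by (simp flip: of_nat_add)
        also have "real (card ?A) = real (card (X - X_good)) * (real (card F) * real (card C))"
          by (simp add: card_image card_cartesian_product)
        also have "\<dots> \<le> \<epsilon> / 4 * real (card X) * (real (card F) * real (card C))"
          by (intro mult_right_mono X_bad) simp
        also have "real (card ?B) = real (card (F - F_good)) * (real (card X) * real (card C))"
          by (simp add: card_image card_cartesian_product)
        also have "\<dots> \<le> \<epsilon> / 4 * real (card F) * (real (card X) * real (card C))"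
          by (intro mult_right_mono F_bad) simp
        also have "real (card ?Y) \<le> \<epsilon> / 2 * ?n"
        proof -
          have "1 \<le> real (card X) * real (card F)" using card_pos by (simp flip: of_nat_mult)
          then have "1 * real (card C) \<le> ?n" by (intro mult_right_mono) simp_all
          then have "\<epsilon> / 2 * real (card C) \<le> \<epsilon> / 2 * ?n" using \<epsilon> by (intro mult_left_mono) simp_all
          then show ?thesis using C(3) by (simp add: card_image)
        qed
        finally have "real (card (Z - good)) \<le> \<epsilon> * ?n" by (simp add: algebra_simps)
        also have "\<dots> = \<epsilon> * real (card (Inl ` (X \<times> F \<times> C) :: (nat \<times> ('a \<Rightarrow> 'a) \<times> nat + 'a) set))"
          by (simp add: card_image card_cartesian_product)
        also have "\<dots> \<le> \<epsilon> * real (card Z)"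
          using finZ \<epsilon> by (intro mult_left_mono of_nat_mono card_mono) (auto simp: Z_def)
        finally show ?thesis .
      qed
    next
      fix g h z assume g: "g \<in> K" and h: "h \<in> K" and "z \<in> good"
      then obtain x q i where z: "z = Inl (x, q, i)" and x: "x \<in> X_good" and q: "q \<in> F_good"
        by (auto simp: good_def)
      have gh: "g \<in> carrier G" "h \<in> carrier G" "g \<otimes> h \<in> K'" using g h K K'I by auto
      have qF: "q \<in> F" and qQ: "q \<in> carrier Q" using q FQ by (auto simp: F_good_def)
      show "act g (act h z) = act (g \<otimes> h) z"
      proof (cases "g = \<one>")
        case True
        then show ?thesis using gh by (simp add: act_def)
      next
        case g1: False
        show ?thesis
        proof (cases "h \<in> Units G")
          case hU: True
          then have h': "act h z = Inl (\<phi> h x, \<rho> h \<otimes>\<^bsub>Q\<^esub> q, i)" and "\<rho> h \<otimes>\<^bsub>Q\<^esub> q \<in> F"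
            using h K'I(2) act_good[OF _ x q] q by (auto simp: z U_def F_good_def)
          show ?thesis
          proof (cases "g \<in> Units G")
            case gU: True
            have UU: "g \<in> U" "h \<in> U" "g \<otimes> h \<in> U" using gU hU g h gh K'I by (auto simp: U_def)
            have \<rho>gh: "\<rho> g \<otimes>\<^bsub>Q\<^esub> (\<rho> h \<otimes>\<^bsub>Q\<^esub> q) = \<rho> (g \<otimes> h) \<otimes>\<^bsub>Q\<^esub> q"
              using gU hU qQ \<rho>Q by (simp add: translation_mult Q.m_assoc)
            then have "\<rho> g \<otimes>\<^bsub>Q\<^esub> (\<rho> h \<otimes>\<^bsub>Q\<^esub> q) \<in> F" using UU(3) q by (simp add: F_good_def)
            then have "act g (act h z) = Inl (\<phi> g (\<phi> h x), \<rho> (g \<otimes> h) \<otimes>\<^bsub>Q\<^esub> q, i)"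
              unfolding h' \<rho>gh[symmetric] by (intro act_unit gU g1)
            also have "\<phi> g (\<phi> h x) = \<phi> (g \<otimes> h) x" using x UU by (simp add: X_good_def)
            finally show ?thesis using act_good[OF UU(3) x q] by (simp add: z)
          next
            case gN: False
            have gN': "g \<in> N" using g K'I gN by (simp add: N_def)
            have ghN: "g \<otimes> h \<in> N" using gh gN by (simp add: N_def mult_in_Units_iff)
            have "act g (act h z) = Inr ((\<rho> h \<otimes>\<^bsub>Q\<^esub> q) g)" unfolding h' by (rule act_nonunit[OF gN'])
            also have "(\<rho> h \<otimes>\<^bsub>Q\<^esub> q) g = q (\<rho> h g)"
              by (intro unit_translations_mult_apply \<rho>Q hU qQ N\<Omega> gN')
            also have "\<rho> h g = g \<otimes> h" using N\<Omega>[OF gN'] by (simp add: right_translation_def)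
            finally show ?thesis using act_nonunit[OF ghN] by (simp add: z)
          qed
        next
          case hN: False
          have hN': "h \<in> N" using h K'I hN by (simp add: N_def)
          have ghN: "g \<otimes> h \<in> N" using gh hN by (simp add: N_def mult_in_Units_iff)
          have "q (g \<otimes> h) = g \<otimes> q h"
            by (intro unit_translations_mult_left qQ N\<Omega> hN' ghN gh)
          then have "act g (Inr (q h)) = Inr (q (g \<otimes> h))"
            using g1 YI[OF qF ghN] by (simp add: act_def)
          then show ?thesis using act_nonunit[OF ghN] act_nonunit[OF hN'] by (simp add: z)
        qed
      qed
    next
      fix g h z assume g: "g \<in> K" and h: "h \<in> K" and ne: "g \<noteq> h" and "z \<in> good"
      then obtain x q i where z: "z = Inl (x, q, i)" and x: "x \<in> X_good" and q: "q \<in> F_good"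
        by (auto simp: good_def)
      have qQ: "q \<in> carrier Q" using q FQ by (auto simp: F_good_def)
      have UN: "g \<in> U \<or> g \<in> N" "h \<in> U \<or> h \<in> N" using g h K'I by (auto simp: U_def N_def)
      have "\<phi> g x \<noteq> \<phi> h x" if "g \<in> U" "h \<in> U" using x that ne by (simp add: X_good_def)
      moreover have "q g \<noteq> q h" if "g \<in> N" "h \<in> N"
        using unit_translations_inj[OF qQ N\<Omega>[OF that(1)] N\<Omega>[OF that(2)]] ne by blast
      ultimately show "act g z \<noteq> act h z"
        using UN act_good[OF _ x q] act_nonunit by (auto simp: z)
    qed
    moreover obtain \<beta> where "bij_betw \<beta> Z {0..<card Z}" using ex_bij_betw_finite_nat[OF finZ] by blast
    ultimately have "almost_action G K \<epsilon> {0..<card Z} (\<lambda>m y. \<beta> (act m (inv_into Z \<beta> y)))"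
      by (intro almost_action_transport K monoid_axioms)
    moreover have "{0..<card Z} \<noteq> {}" using finZ \<open>Z \<noteq> {}\<close> by (simp add: card_gt_0_iff)
    ultimately show ?thesis by blast
  qed
  then show ?thesis using monoid_axioms by (simp add: sofic_monoid_def)
qed

theorem corollary4p2:
  fixes M :: "('a, 'b) monoid_scheme"
  assumes "monoid M"
    and "sofic_group (units_of M)"
    and "\<And>H. \<lbrakk>H \<in> carrier M // green_H M; H \<inter> Units M = {}\<rbrakk> \<Longrightarrow>
           amenable_group (schutzenberger_group M H)"
    and "\<And>D. D \<in> carrier M // green_D M \<Longrightarrow>
           finite {L \<in> carrier M // green_L M. L \<subseteq> D}"
  shows "sofic_monoid M"
proof -
  interpret monoid M by fact
  interpret directly_finite_monoid M
    by (intro directly_finite_if_finite_L_classes assms(4) quotientI) simp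
  note D = equiv_green_D
  have "\<exists>\<Omega>. N \<subseteq> \<Omega> \<and> translated_set M \<Omega> \<and> folner_group (unit_translations M \<Omega>)"
    if N: "finite N" "N \<subseteq> carrier M - Units M" for N
  proof -
    \<comment> \<open>A union of \<open>\<D>\<close>-classes of non-units: it is closed under right translation by units, and all its
      \<open>\<H>\<close>-classes have amenable Schuetzenberger groups.\<close>
    define \<Omega> where "\<Omega> = green_D M `` N"
    have N\<Omega>: "N \<subseteq> \<Omega>" using N D by (auto simp: \<Omega>_def equiv_def refl_on_def)
    have D_closed: "y \<in> \<Omega>" if "x \<in> \<Omega>" "(x, y) \<in> green_D M" for x y
      using that D by (auto simp: \<Omega>_def equiv_def dest: transD)
    have \<Omega>: "\<Omega> \<subseteq> carrier M" "\<Omega> \<inter> Units M = {}"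
      using N D green_D_Units by (auto simp: \<Omega>_def equiv_def)
    interpret translated_set M \<Omega>
    proof
      show "\<Omega> \<subseteq> carrier M" by (rule \<Omega>)
      show "x \<otimes>\<^bsub>M\<^esub> g \<in> \<Omega>" if "x \<in> \<Omega>" "g \<in> Units M" for x g
        using that \<Omega> green_R_mult_unit[of x g] green_R_subset_green_D D_closed by blast
    qed
    have "{L \<in> carrier M // green_L M. L \<subseteq> \<Omega>} \<subseteq>
        (\<Union>n\<in>N. {L \<in> carrier M // green_L M. L \<subseteq> green_D M `` {n}})"
    proof
      fix L assume L: "L \<in> {L \<in> carrier M // green_L M. L \<subseteq> \<Omega>}"
      then obtain x where x: "x \<in> carrier M" "L = green_L M `` {x}" by (auto elim: quotientE)
      then have "x \<in> L" by (simp add: green_L_def)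
      then obtain n where n: "n \<in> N" "(n, x) \<in> green_D M" using L by (auto simp: \<Omega>_def)
      have "L \<subseteq> green_D M `` {n}"
        using n(2) x(2) green_L_subset_green_D D by (auto simp: equiv_def dest: transD)
      then show "L \<in> (\<Union>n\<in>N. {L \<in> carrier M // green_L M. L \<subseteq> green_D M `` {n}})"
        using L n(1) by blast
    qed
    moreover have "finite (\<Union>n\<in>N. {L \<in> carrier M // green_L M. L \<subseteq> green_D M `` {n}})"
      using N by (intro finite_UN_I assms(4) quotientI) auto
    ultimately have "finite {L \<in> carrier M // green_L M. L \<subseteq> \<Omega>}" by (rule finite_subset)
    moreover have "folner_group (schutzenberger_group M H)"
      if "H \<in> carrier M // green_H M" "H \<subseteq> \<Omega>" for H
      using that \<Omega>(2) by (intro folner_group_if_amenable assms(3)) auto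
    ultimately have "folner_group Q"
      using D_closed by (intro folner_group_unit_translations)
    then show ?thesis using N\<Omega> translated_set_axioms by blast
  qed
  then show ?thesis by (intro sofic_if_folner_unit_translations assms(2))
qed

end
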